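(* Let $G\in\mathcal{G}$ with degree $d_G>0$ and let $\mu:[2,\infty)\to\mathbb{R}^+$ be a positive function satisfying $\mu(\tau)\le\frac12\log\tau$ for $\tau\in[2,\infty)$. For $\tau\in[2,\infty)$ and $z\in\mathbb{D}$ put $$G_\tau(z):=G\left(\tfrac12+\tfrac{\mu(\tau)}{\log\tau}\,z+i\tau\right).$$ Assume that there is a sequence $(\tau_k)_k$ of real numbers $\tau_k\in[2,\infty)$ with $\lim_{k\to\infty}\tau_k=\infty$ such that $(G_{\tau_k})_k$ converges locally uniformly on $\mathbb{D}$ to a limit function $g$. (a) If $\lim_{k\to\infty}\mu(\tau_k)=\infty$, then $g\equiv0$ or $g\equiv\infty$. (b) If $\lim_{k\to\infty}\mu(\tau_k)=c$ with some $c\in(0,\infty)$, then $g\equiv\infty$ or $g$ is of the form $$g(z)=f_g(z)\exp\left(-\tfrac{c\,d_G}{2}z+i\ell\right)$$ with some $\ell\in[0,\pi)$ and some meromorphic function $f_g$ on $\mathbb{D}$ satisfying $f_g(z)=\overline{f_g(-\overline z)}$ for $z\in\mathbb{D}$. (c) If $\lim_{k\to\infty}\mu(\tau_k)=0$, then $g\equiv\infty$ or $g$ is of the form $$g(z)=f_g(z)\exp(i\ell)$$ with some $\ell\in[0,\pi)$ and some meromorphic function $f_g$ on $\mathbb{D}$ satisfying $f_g(z)=\overline{f_g(-\overline z)}$ for $z\in\mathbb{D}$.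
   Context: $\mathbb{D}$ is the open unit disc. Local uniform convergence of meromorphic functions is with respect to the chordal metric on the Riemann sphere $\widehat{\mathbb{C}}$ (so the limit is meromorphic or identically $\infty$). For a parameter tuple $p=(\omega,Q,\lambda_1,\dots,\lambda_f,\mu_1,\dots,\mu_f)$, $f\in\mathbb{N}_0$, with positive reals $Q,\lambda_1,\dots,\lambda_f$ and complex numbers $\omega,\mu_1,\dots,\mu_f$, $|\omega|=1$, put $$\Delta_p(s):=\omega Q^{1-2s}\prod_{j=1}^f\frac{\Gamma(\lambda_j(1-s)+\overline{\mu_j})}{\Gamma(\lambda_js+\mu_j)}$$ and $d_p:=2\sum_{j=1}^f\lambda_j$ ($d_p=0$ if $f=0$). Let $\mathcal{D}=\{\sigma+it:0<\sigma<1,\ t>0\}$. A function $G\not\equiv0$ belongs to the class $\mathcal{G}$ if it is meromorphic in $\mathcal{D}$ and there is such a tuple $p$ with $G(s)=\Delta_p(s)\overline{G(1-\overline s)}$ for $s\in\mathcal{D}$. The function $\Delta_p$ and the number $d_p$ are uniquely determined by $G$; the degree of $G$ is $d_G:=d_p$. *)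

theory Defs
  imports "HOL-Complex_Analysis.Complex_Analysis"
begin

section \<open>The Riemann sphere with the chordal metric\<close>

datatype riemann_sphere = Fin complex | Infty

fun chordal_dist :: "riemann_sphere \<Rightarrow> riemann_sphere \<Rightarrow> real" where
  "chordal_dist (Fin z) (Fin w) = 2 * cmod (z - w) / (sqrt (1 + (cmod z)\<^sup>2) * sqrt (1 + (cmod w)\<^sup>2))"
| "chordal_dist (Fin z) Infty = 2 / sqrt (1 + (cmod z)\<^sup>2)"
| "chordal_dist Infty (Fin w) = 2 / sqrt (1 + (cmod w)\<^sup>2)"
| "chordal_dist Infty Infty = 0"

text \<open>
  Stereographic projection onto the Euclidean unit sphere, used only to show that the chordal
  distance is a metric.
\<close>

fun stereographic :: "riemann_sphere \<Rightarrow> complex \<times> real" where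
  "stereographic (Fin z) = ((2 / (1 + (cmod z)\<^sup>2)) *\<^sub>R z, ((cmod z)\<^sup>2 - 1) / (1 + (cmod z)\<^sup>2))"
| "stereographic Infty = (0, 1)"

lemma one_plus_sq_pos: "0 < 1 + (cmod z)\<^sup>2"
  by (simp add: add_pos_nonneg)

lemma chordal_dist_stereographic_FF:
  "dist (stereographic (Fin z)) (stereographic (Fin w)) = chordal_dist (Fin z) (Fin w)"
proof -
  define x y u v where "x = Re z" "y = Im z" "u = Re w" "v = Im w"
  define a b where "a = 1 + (x\<^sup>2 + y\<^sup>2)" and "b = 1 + (u\<^sup>2 + v\<^sup>2)"
  have a: "1 + (cmod z)\<^sup>2 = a" "(cmod z)\<^sup>2 = a - 1" and b: "1 + (cmod w)\<^sup>2 = b" "(cmod w)\<^sup>2 = b - 1"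
    by (simp_all add: a_def b_def cmod_power2 x_y_u_v_def)
  have pos: "a > 0" "b > 0"
    using one_plus_sq_pos[of z] one_plus_sq_pos[of w] a b by simp_all
  have sq: "(dist (stereographic (Fin z)) (stereographic (Fin w)))\<^sup>2 =
        (2 * x / a - 2 * u / b)\<^sup>2 + (2 * y / a - 2 * v / b)\<^sup>2 + ((a - 2) / a - (b - 2) / b)\<^sup>2"
    (is "?L = ?R")
  proof -
    have "?L = (cmod ((2 / a) *\<^sub>R z - (2 / b) *\<^sub>R w))\<^sup>2 + ((a - 2) / a - (b - 2) / b)\<^sup>2"
      by (simp add: dist_norm norm_Pair a b)
    also have "(cmod ((2 / a) *\<^sub>R z - (2 / b) *\<^sub>R w))\<^sup>2
        = (2 * x / a - 2 * u / b)\<^sup>2 + (2 * y / a - 2 * v / b)\<^sup>2"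
      by (simp add: cmod_power2 x_y_u_v_def)
    finally show ?thesis .
  qed
  also have "\<dots> = ((2 * x * b - 2 * u * a)\<^sup>2 + (2 * y * b - 2 * v * a)\<^sup>2
        + ((a - 2) * b - (b - 2) * a)\<^sup>2) / (a * b)\<^sup>2"
  proof -
    have "2 * x / a - 2 * u / b = (2 * x * b - 2 * u * a) / (a * b)"
      and "2 * y / a - 2 * v / b = (2 * y * b - 2 * v * a) / (a * b)"
      and "(a - 2) / a - (b - 2) / b = ((a - 2) * b - (b - 2) * a) / (a * b)"
      using pos by (simp_all add: field_simps)
    then show ?thesis
      by (simp only: power_divide add_divide_distrib)
  qed
  also have "(2 * x * b - 2 * u * a)\<^sup>2 + (2 * y * b - 2 * v * a)\<^sup>2
        + ((a - 2) * b - (b - 2) * a)\<^sup>2 = 4 * ((x - u)\<^sup>2 + (y - v)\<^sup>2) * (a * b)"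
    unfolding a_def b_def by algebra
  also have "4 * ((x - u)\<^sup>2 + (y - v)\<^sup>2) * (a * b) / (a * b)\<^sup>2
      = 4 * ((x - u)\<^sup>2 + (y - v)\<^sup>2) / (a * b)"
    by (simp add: power2_eq_square)
  finally have "(dist (stereographic (Fin z)) (stereographic (Fin w)))\<^sup>2
      = 4 * ((x - u)\<^sup>2 + (y - v)\<^sup>2) / (a * b)" .
  moreover have "(chordal_dist (Fin z) (Fin w))\<^sup>2 = 4 * ((x - u)\<^sup>2 + (y - v)\<^sup>2) / (a * b)"
  proof -
    have "(chordal_dist (Fin z) (Fin w))\<^sup>2 = 4 * (cmod (z - w))\<^sup>2 / (a * b)"
      using pos by (simp add: power_divide power_mult_distrib a b)
    also have "(cmod (z - w))\<^sup>2 = (x - u)\<^sup>2 + (y - v)\<^sup>2"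
      by (simp add: cmod_power2 x_y_u_v_def)
    finally show ?thesis .
  qed
  moreover have "0 \<le> chordal_dist (Fin z) (Fin w)"
    by simp
  ultimately show ?thesis
    by (metis power2_eq_imp_eq zero_le_dist)
qed

lemma chordal_dist_stereographic_FI:
  "dist (stereographic (Fin z)) (stereographic Infty) = chordal_dist (Fin z) Infty"
proof -
  define a where "a = 1 + (cmod z)\<^sup>2"
  have a: "1 + (cmod z)\<^sup>2 = a" "(cmod z)\<^sup>2 = a - 1" and pos: "a > 0"
    using one_plus_sq_pos[of z] by (simp_all add: a_def)
  have "(dist (stereographic (Fin z)) (stereographic Infty))\<^sup>2
      = (cmod ((2 / a) *\<^sub>R z))\<^sup>2 + ((a - 2) / a - 1)\<^sup>2"
    by (simp add: dist_norm norm_Pair a del: norm_scaleR)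
  also have "(cmod ((2 / a) *\<^sub>R z))\<^sup>2 = (2 / a)\<^sup>2 * (a - 1)"
    by (simp add: power_mult_distrib power_divide a)
  also have "(2 / a)\<^sup>2 * (a - 1) + ((a - 2) / a - 1)\<^sup>2 = 4 / a"
    using pos by (simp add: field_simps power2_eq_square)
  also have "\<dots> = (chordal_dist (Fin z) Infty)\<^sup>2"
    using pos by (simp add: power_divide a)
  finally show ?thesis
    by (rule power2_eq_imp_eq) simp_all
qed

lemma chordal_dist_stereographic:
  "chordal_dist x y = dist (stereographic x) (stereographic y)"
proof (cases x; cases y)
  fix w assume "x = Infty" "y = Fin w"
  then show ?thesis
    using chordal_dist_stereographic_FI[of w] by (simp add: dist_commute)
qed (use chordal_dist_stereographic_FF chordal_dist_stereographic_FI in \<open>simp_all del: stereographic.simps\<close>)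

lemma chordal_dist_eq_0_iff: "chordal_dist x y = 0 \<longleftrightarrow> x = y"
proof -
  have "1 + (cmod z)\<^sup>2 \<noteq> 0" for z
    using one_plus_sq_pos[of z] by linarith
  then show ?thesis
    by (cases x; cases y) auto
qed

instantiation riemann_sphere :: metric_space
begin

definition dist_riemann_sphere :: "riemann_sphere \<Rightarrow> riemann_sphere \<Rightarrow> real" where
  "dist_riemann_sphere = chordal_dist"

definition uniformity_riemann_sphere :: "(riemann_sphere \<times> riemann_sphere) filter" where
  "uniformity_riemann_sphere = (INF e\<in>{0<..}. principal {(x, y). dist x y < e})"

definition open_riemann_sphere :: "riemann_sphere set \<Rightarrow> bool" where
  "open_riemann_sphere U \<longleftrightarrow> (\<forall>x\<in>U. eventually (\<lambda>(x', y). x' = x \<longrightarrow> y \<in> U) uniformity)"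

instance
proof
  fix x y z :: riemann_sphere
  show "dist x y = 0 \<longleftrightarrow> x = y"
    by (simp add: dist_riemann_sphere_def chordal_dist_eq_0_iff)
  show "dist x y \<le> dist x z + dist y z"
    by (simp add: dist_riemann_sphere_def chordal_dist_stereographic dist_triangle2)
qed (fact uniformity_riemann_sphere_def open_riemann_sphere_def)+

end

text \<open>
  In the library a meromorphic function is a total function on the complex numbers, which
  (if nicely meromorphic) takes the dummy value 0 at its poles. This is the corresponding map
  into the Riemann sphere.
\<close>

definition to_sphere :: "(complex \<Rightarrow> complex) \<Rightarrow> complex \<Rightarrow> riemann_sphere" where
  "to_sphere f z = (if is_pole f z then Infty else Fin (f z))"

definition locally_uniform_limit ::
  "complex set \<Rightarrow> (nat \<Rightarrow> complex \<Rightarrow> riemann_sphere) \<Rightarrow> (complex \<Rightarrow> riemann_sphere) \<Rightarrow> bool" where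
  "locally_uniform_limit S F g \<longleftrightarrow>
     (\<forall>K. compact K \<and> K \<subseteq> S \<longrightarrow> uniform_limit K F g sequentially)"


section \<open>The class of functions\<close>

record fe_param =
  fe_omega :: complex
  fe_Q :: real
  fe_num :: nat
  fe_lam :: "nat \<Rightarrow> real"
  fe_mu :: "nat \<Rightarrow> complex"

definition admissible :: "fe_param \<Rightarrow> bool" where
  "admissible p \<longleftrightarrow> cmod (fe_omega p) = 1 \<and> fe_Q p > 0 \<and> (\<forall>j\<in>{1..fe_num p}. fe_lam p j > 0)"

definition Delta :: "fe_param \<Rightarrow> complex \<Rightarrow> complex" where
  "Delta p s = fe_omega p * of_real (fe_Q p) powr (1 - 2 * s) *
     (\<Prod>j = 1..fe_num p. Gamma (of_real (fe_lam p j) * (1 - s) + cnj (fe_mu p j)) /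
                       Gamma (of_real (fe_lam p j) * s + fe_mu p j))"

definition param_degree :: "fe_param \<Rightarrow> real" where
  "param_degree p = 2 * (\<Sum>j = 1..fe_num p. fe_lam p j)"

definition half_strip :: "complex set" where
  "half_strip = {s. 0 < Re s \<and> Re s < 1 \<and> 0 < Im s}"

text \<open>
  The functional equation is an identity of meromorphic functions. As \<open>Delta p\<close> may have
  poles in the half-strip, and the total functions take dummy values at poles, it is required
  to hold pointwise only off a set without accumulation points in the half-strip.
\<close>

definition satisfies_fe :: "(complex \<Rightarrow> complex) \<Rightarrow> fe_param \<Rightarrow> bool" where
  "satisfies_fe G p \<longleftrightarrow> (\<forall>\<^sub>\<approx>s\<in>half_strip. G s = Delta p s * cnj (G (1 - cnj s)))"

definition class_G :: "(complex \<Rightarrow> complex) set" where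
  "class_G = {G. G nicely_meromorphic_on half_strip \<and> (\<exists>s\<in>half_strip. G s \<noteq> 0) \<and>
                 (\<exists>p. admissible p \<and> satisfies_fe G p)}"

text \<open>
  The parameter tuple is not determined by \<open>G\<close>, but its degree is, so the choice made here is
  immaterial.
\<close>

definition degree_G :: "(complex \<Rightarrow> complex) \<Rightarrow> real" where
  "degree_G G = param_degree (SOME p. admissible p \<and> satisfies_fe G p)"

definition rescaled :: "(complex \<Rightarrow> complex) \<Rightarrow> (real \<Rightarrow> real) \<Rightarrow> real \<Rightarrow> complex \<Rightarrow> complex" where
  "rescaled G \<mu> \<tau> z = G (1 / 2 + of_real (\<mu> \<tau> / ln \<tau>) * z + \<i> * of_real \<tau>)"

end

theory Submission
  imports Defs "HOL-Real_Asymp.Real_Asymp"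
begin

text \<open>
  Put \<open>r = \<mu>(\<tau>) / ln \<tau>\<close> and \<open>s = 1/2 + r z + i \<tau>\<close>. Since \<open>1 - cnj s = 1/2 + r (- cnj z) + i \<tau>\<close>, the
  functional equation of \<open>G\<close> reads \<open>G\<^sub>\<tau>(z) = Delta(s) cnj (G\<^sub>\<tau>(- cnj z))\<close> in the rescaled coordinate, and
  everything depends on the behaviour of the factor \<open>Delta(s)\<close> as \<open>\<tau>\<close> tends to infinity.

  On the critical line \<open>Delta\<close> is unimodular (\<open>norm_Delta_critical_line\<close>). Its logarithmic derivative at
  height about \<open>\<tau>\<close> is \<open>- d ln \<tau> + O(1)\<close>, because the digamma function is \<open>ln \<bar>Im w\<bar> + O(1)\<close> on
  vertical strips (\<open>Digamma_minus_ln_Im_bound\<close>, \<open>vertical_growth_Delta\<close>). Integrating from the critical line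
  to \<open>s\<close> gives \<open>Delta(s) = u exp (- d \<mu>(\<tau>) z + O(r))\<close> with \<open>\<bar>u\<bar> = 1\<close>; this is
  \<open>rescaled_functional_equation\<close>. The error \<open>O(r)\<close> tends to \<open>0\<close> when \<open>\<mu>(\<tau>)\<close> stays bounded, and it stays
  bounded in any case, so that it is dominated by \<open>d \<mu>(\<tau>)\<close> when \<open>\<mu>(\<tau>)\<close> tends to infinity.

  A limit \<open>g\<close> in the chordal metric is identically infinite or meromorphic
  (\<open>meromorphic_limit_cases\<close>). In the second case one can pass to the limit in the functional equation
  at all points where \<open>g(z)\<close> and \<open>g(- cnj z)\<close> are finite (\<open>limit_cases_of_functional_equation\<close>). If
  \<open>\<mu>(\<tau>)\<close> tends to infinity and \<open>Re z > 0\<close>, then the factor tends to \<open>0\<close>, so \<open>g\<close> vanishes on the right half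
  of the disc and hence everywhere. If \<open>\<mu>(\<tau>)\<close> tends to \<open>c\<close>, then along a subsequence the factor tends to
  \<open>exp (2 i l - d c z)\<close> with \<open>0 \<le> l < \<pi>\<close>, and dividing \<open>g\<close> by the square root of this
  function produces a function symmetric under \<open>z \<mapsto> - cnj z\<close> (\<open>symmetrised_function\<close>). For
  \<open>c = 0\<close> the square root is the constant \<open>exp (i l)\<close>.
\<close>

section \<open>The digamma function on vertical strips\<close>

lemma Im_nonzero_imp_notin_nonpos_Ints: "Im w \<noteq> 0 \<Longrightarrow> w \<notin> \<int>\<^sub>\<le>\<^sub>0"
  using nonpos_Ints_subset_nonpos_Reals by (auto simp: complex_nonpos_Reals_iff)

text \<open>
  The increment is the integral of \<open>1 / x\<close> over the segment from \<open>w\<close> to \<open>w + 1\<close>, and on that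
  segment \<open>1 / x\<close> differs from \<open>1 / w\<close> by at most \<open>1 / (Re w)\<^sup>2\<close>. These errors are summable along
  \<open>w, w + 1, w + 2, \<dots>\<close>.
\<close>

lemma Ln_increment_bound:
  fixes w :: complex
  assumes "Re w > 0"
  shows "cmod (Ln (w + 1) - Ln w - inverse w) \<le> 1 / (Re w)\<^sup>2"
proof -
  let ?S = "closed_segment w (w + 1)"
  have Re_S: "Re x \<ge> Re w \<and> cmod (x - w) \<le> 1" if "x \<in> ?S" for x
  proof -
    from that obtain u :: real where u: "0 \<le> u" "u \<le> 1" "x = (1 - u) *\<^sub>R w + u *\<^sub>R (w + 1)"
      by (auto simp: in_segment)
    then have "x - w = of_real u"
      by (simp add: algebra_simps scaleR_conv_of_real)
    with u show ?thesis
      by (metis Re_complex_of_real abs_of_nonneg diff_ge_0_iff_ge minus_complex.simps(1) norm_of_real)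
  qed
  have "cmod ((Ln (w + 1) - (w + 1) * inverse w) - (Ln w - w * inverse w))
      \<le> 1 / (Re w)\<^sup>2 * cmod ((w + 1) - w)"
  proof (rule field_differentiable_bound[of ?S _ "\<lambda>x. inverse x - inverse w"])
    fix x assume x: "x \<in> ?S"
    have pos: "Re x > 0" and nz: "x \<noteq> 0" "w \<noteq> 0"
      using Re_S[OF x] assms by auto
    then have "x \<notin> \<real>\<^sub>\<le>\<^sub>0"
      by (auto simp: complex_nonpos_Reals_iff)
    then show "((\<lambda>x. Ln x - x * inverse w) has_field_derivative inverse x - inverse w) (at x within ?S)"
      by (auto intro!: derivative_eq_intros simp: divide_inverse)
    have "cmod (inverse x - inverse w) = cmod (w - x) / (cmod x * cmod w)"
      using nz by (simp add: divide_simps flip: norm_mult norm_divide)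
    also have "\<dots> \<le> 1 / (Re w * Re w)"
    proof (rule frac_le)
      show "Re w * Re w \<le> cmod x * cmod w"
        using Re_S[OF x] assms complex_Re_le_cmod[of x] complex_Re_le_cmod[of w]
        by (intro mult_mono) auto
    qed (use Re_S[OF x] assms in \<open>auto simp: norm_minus_commute\<close>)
    finally show "cmod (inverse x - inverse w) \<le> 1 / (Re w)\<^sup>2"
      by (simp add: power2_eq_square)
  qed auto
  moreover have "(w + 1) * inverse w = w * inverse w + inverse w"
    by (simp add: algebra_simps)
  ultimately show ?thesis
    by (simp add: algebra_simps)
qed

text \<open>
  The digamma function is the limit of \<open>ln m - (\<Sum>n<m. 1 / (w + n))\<close>. The sum telescopes to
  \<open>Ln (w + m) - Ln w\<close> once each term is replaced by an increment of the logarithm, at a total cost of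
  at most \<open>\<Sum>n. 1 / (n + 1)\<^sup>2 = \<pi>\<^sup>2 / 6 < 3\<close>, and \<open>Ln (w + m) - ln m\<close> tends to \<open>0\<close>.
\<close>

lemma Digamma_minus_Ln_bound:
  fixes w :: complex
  assumes "Re w \<ge> 1"
  shows "cmod (Digamma w - Ln w) \<le> 3"
proof -
  have nz: "w \<noteq> 0" using assms by auto
  define D where "D m = (\<Sum>n<m. Ln (w + of_nat n + 1) - Ln (w + of_nat n) - inverse (w + of_nat n))" for m
  have D_eq: "D m = Ln (w + of_nat m) - Ln w - (\<Sum>n<m. inverse (w + of_nat n))" for m
    unfolding D_def by (induction m) (simp_all add: add_ac)
  have D_bound: "cmod (D m) \<le> 3" for m
  proof -
    have "cmod (D m) \<le> (\<Sum>n<m. 1 / (of_nat (Suc n))\<^sup>2)"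
      unfolding D_def
    proof (rule sum_norm_le)
      fix n
      have "cmod (Ln (w + of_nat n + 1) - Ln (w + of_nat n) - inverse (w + of_nat n))
          \<le> 1 / (Re (w + of_nat n))\<^sup>2"
        by (rule Ln_increment_bound) (use assms in auto)
      also have "\<dots> \<le> 1 / (of_nat (Suc n))\<^sup>2"
        using assms by (intro divide_left_mono power_mono mult_pos_pos) auto
      finally show "cmod (Ln (w + of_nat n + 1) - Ln (w + of_nat n) - inverse (w + of_nat n))
          \<le> 1 / (of_nat (Suc n))\<^sup>2" .
    qed
    also have "\<dots> \<le> (\<Sum>n. 1 / (real (Suc n))\<^sup>2)"
      using inverse_squares_sums by (intro sum_le_suminf) (auto simp: sums_iff add_ac)
    also have "\<dots> = pi\<^sup>2 / 6"
      using inverse_squares_sums by (simp add: sums_iff add_ac)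
    also have "\<dots> \<le> 3"
      using power_mono[of pi 4 2] pi_less_4 by simp
    finally show ?thesis .
  qed
  have lim: "(\<lambda>m. Ln (w + of_nat m) - of_real (ln (real m))) \<longlonglongrightarrow> 0"
  proof -
    have "(\<lambda>m. Ln (1 + w / of_nat m)) \<longlonglongrightarrow> Ln (1 + 0)"
      by (intro tendsto_intros lim_const_over_n) auto
    moreover have "\<forall>\<^sub>F m in sequentially. Ln (1 + w / of_nat m) = Ln (w + of_nat m) - of_real (ln (real m))"
      using eventually_gt_at_top[of 0]
    proof eventually_elim
      case (elim m)
      have "1 + w / of_nat m \<noteq> 0"
      proof
        assume "1 + w / of_nat m = 0"
        then have "w + of_nat m = 0" using elim by (simp add: field_simps)
        then have "Re (w + of_nat m) = 0" by simp
        then show False using assms by simp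
      qed
      then have "Ln (of_real (real m) * (1 + w / of_nat m)) = of_real (ln (real m)) + Ln (1 + w / of_nat m)"
        using elim by (subst Ln_times_of_real) auto
      moreover have "of_real (real m) * (1 + w / of_nat m) = w + of_nat m"
        using elim by (simp add: field_simps)
      ultimately show ?case by simp
    qed
    ultimately show ?thesis
      by (auto intro: Lim_transform_eventually)
  qed
  have "(\<lambda>m. D m) \<longlonglongrightarrow> Digamma w + 0 - Ln w"
  proof -
    have "(\<lambda>m. (of_real (ln (real m)) - (\<Sum>n<m. inverse (w + of_nat n)))
         + (Ln (w + of_nat m) - of_real (ln (real m))) - Ln w) \<longlonglongrightarrow> Digamma w + 0 - Ln w"
      by (intro tendsto_intros Digamma_LIMSEQ lim nz)
    then show ?thesis
      by (simp add: D_eq algebra_simps)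
  qed
  then have "D \<longlonglongrightarrow> Digamma w - Ln w" by simp
  then show ?thesis
    by (rule Lim_norm_ubound[rotated]) (auto simp: D_bound)
qed

lemma Digamma_add_of_nat:
  fixes w :: complex
  assumes "Im w \<noteq> 0"
  shows "Digamma (w + of_nat n) = Digamma w + (\<Sum>k<n. 1 / (w + of_nat k))"
proof (induction n)
  case (Suc n)
  have "w + of_nat n \<noteq> 0"
    using assms by (auto simp: complex_eq_iff)
  then have "Digamma (w + of_nat n + 1) = Digamma (w + of_nat n) + 1 / (w + of_nat n)"
    by (rule Digamma_plus1)
  then show ?case by (simp add: Suc add_ac)
qed simp

lemma Ln_minus_ln_Im_bound:
  fixes v :: complex
  assumes "\<bar>Re v\<bar> \<le> B" "1 \<le> \<bar>Im v\<bar>"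
  shows "cmod (Ln v - of_real (ln \<bar>Im v\<bar>)) \<le> ln (1 + B) + pi"
proof -
  have nz: "v \<noteq> 0" using assms by auto
  have B: "B \<ge> 0" using assms by linarith
  have "cmod v \<le> \<bar>Re v\<bar> + \<bar>Im v\<bar>" by (rule cmod_le)
  also have "\<dots> \<le> (1 + B) * \<bar>Im v\<bar>"
    using assms B mult_left_mono[of 1 "\<bar>Im v\<bar>" B] by (simp add: algebra_simps)
  finally have "ln (cmod v) \<le> ln ((1 + B) * \<bar>Im v\<bar>)"
    using nz by (intro ln_mono) auto
  also have "\<dots> = ln (1 + B) + ln \<bar>Im v\<bar>"
    using assms B by (subst ln_mult) auto
  finally have "ln (cmod v) - ln \<bar>Im v\<bar> \<le> ln (1 + B)" by simp
  moreover have "ln \<bar>Im v\<bar> \<le> ln (cmod v)"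
    using abs_Im_le_cmod[of v] assms nz by simp
  ultimately have "\<bar>Re (Ln v - of_real (ln \<bar>Im v\<bar>))\<bar> \<le> ln (1 + B)"
    using nz by simp
  moreover have "\<bar>Im (Ln v - of_real (ln \<bar>Im v\<bar>))\<bar> \<le> pi"
    using mpi_less_Im_Ln[OF nz] Im_Ln_le_pi[OF nz] by simp
  ultimately show ?thesis
    using cmod_le[of "Ln v - of_real (ln \<bar>Im v\<bar>)"] by linarith
qed

text \<open>
  A weak form of Stirling's formula for the logarithmic derivative of the Gamma function. The recurrence
  moves the argument to the right until its real part is at least \<open>1\<close>; each of these boundedly many
  steps costs at most \<open>1\<close>, because all arguments stay at distance at least \<open>1\<close> from the real axis.
\<close>

lemma Digamma_minus_ln_Im_bound:
  obtains C where
    "\<And>w :: complex. \<bar>Re w\<bar> \<le> A \<Longrightarrow> 1 \<le> \<bar>Im w\<bar> \<Longrightarrow> cmod (Digamma w - of_real (ln \<bar>Im w\<bar>)) \<le> C"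
proof -
  define N where "N = nat \<lceil>A\<rceil> + 1"
  show ?thesis
  proof (rule that)
    fix w :: complex assume w: "\<bar>Re w\<bar> \<le> A" "1 \<le> \<bar>Im w\<bar>"
    have "real N \<ge> A + 1" unfolding N_def by linarith
    then have "Re (w + of_nat N) \<ge> 1" using w by simp
    then have 1: "cmod (Digamma (w + of_nat N) - Ln (w + of_nat N)) \<le> 3"
      by (rule Digamma_minus_Ln_bound)
    have 2: "cmod (\<Sum>k<N. 1 / (w + of_nat k)) \<le> of_nat (card {..<N}) * 1"
    proof (rule sum_norm_bound)
      fix k
      have "1 \<le> cmod (w + of_nat k)"
        using abs_Im_le_cmod[of "w + of_nat k"] w by simp
      then show "cmod (1 / (w + of_nat k)) \<le> 1" by (simp add: norm_divide divide_simps)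
    qed
    have 3: "cmod (Ln (w + of_nat N) - of_real (ln \<bar>Im (w + of_nat N)\<bar>)) \<le> ln (1 + (A + N)) + pi"
      by (rule Ln_minus_ln_Im_bound) (use w in auto)
    have "Im w \<noteq> 0" using w by auto
    then have "Digamma w - of_real (ln \<bar>Im w\<bar>) =
        (Digamma (w + of_nat N) - Ln (w + of_nat N))
        + (Ln (w + of_nat N) - of_real (ln \<bar>Im (w + of_nat N)\<bar>)) - (\<Sum>k<N. 1 / (w + of_nat k))"
      by (subst Digamma_add_of_nat) auto
    also have "cmod \<dots> \<le> (3 + (ln (1 + (A + N)) + pi)) + N"
      using 2 by (intro norm_triangle_le_diff add_mono norm_triangle_le[OF add_mono[OF 1 3]]) simp
    finally show "cmod (Digamma w - of_real (ln \<bar>Im w\<bar>)) \<le> (3 + (ln (1 + (A + N)) + pi)) + N" .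
  qed
qed

section \<open>Growth of the factor \<open>Delta\<close> near the critical line\<close>

text \<open>
  The estimate \<open>log f(s) - log f(s0) = A (s - s0) + O(s - s0)\<close> with implied constant \<open>C\<close>, written with
  the exponential function to avoid the choice of a branch of the logarithm. In this form it passes to
  products and quotients by adding or subtracting the exponents.
\<close>

definition log_increment ::
  "(complex \<Rightarrow> complex) \<Rightarrow> complex \<Rightarrow> real \<Rightarrow> real \<Rightarrow> complex \<Rightarrow> bool" where
  "log_increment f s0 A C s \<longleftrightarrow>
     (\<exists>E. cmod E \<le> C * cmod (s - s0) \<and> f s = f s0 * exp (of_real A * (s - s0) + E))"

lemma log_increment_mult:
  assumes "log_increment f s0 A C s" "log_increment g s0 B D s"
  shows "log_increment (\<lambda>s. f s * g s) s0 (A + B) (C + D) s"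
proof -
  obtain E where E: "cmod E \<le> C * cmod (s - s0)" "f s = f s0 * exp (of_real A * (s - s0) + E)"
    using assms unfolding log_increment_def by blast
  obtain E' where E': "cmod E' \<le> D * cmod (s - s0)" "g s = g s0 * exp (of_real B * (s - s0) + E')"
    using assms unfolding log_increment_def by blast
  have "cmod (E + E') \<le> (C + D) * cmod (s - s0)"
    using norm_triangle_ineq[of E E'] E(1) E'(1) by (simp add: algebra_simps)
  moreover have "f s * g s = f s0 * g s0 *
      exp ((of_real A * (s - s0) + E) + (of_real B * (s - s0) + E'))"
    unfolding E(2) E'(2) by (subst exp_add) (simp only: mult_ac)
  moreover have "(of_real A * (s - s0) + E) + (of_real B * (s - s0) + E') =
      of_real (A + B) * (s - s0) + (E + E')"
    by (simp add: algebra_simps)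
  ultimately show ?thesis
    unfolding log_increment_def by metis
qed

lemma log_increment_inverse:
  assumes "log_increment f s0 A C s"
  shows "log_increment (\<lambda>s. inverse (f s)) s0 (- A) C s"
proof -
  obtain E where E: "cmod E \<le> C * cmod (s - s0)" "f s = f s0 * exp (of_real A * (s - s0) + E)"
    using assms unfolding log_increment_def by blast
  have "inverse (f s) = inverse (f s0) * exp (- (of_real A * (s - s0) + E))"
    unfolding E(2) by (simp only: inverse_mult_distrib exp_minus)
  moreover have "- (of_real A * (s - s0) + E) = of_real (- A) * (s - s0) + (- E)"
    by (simp add: algebra_simps)
  ultimately show ?thesis
    unfolding log_increment_def using E(1) by (metis norm_minus_cancel)
qed

text \<open>
  The integrated form of the estimate \<open>a ln t + O(1)\<close> for the logarithmic derivative of \<open>f\<close> near the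
  point of height \<open>t\<close> on the critical line. Radius \<open>1/2\<close> suffices for the rescaled functions, since
  \<open>\<mu>(t) / ln t \<le> 1/2\<close>.
\<close>

definition vertical_growth :: "(complex \<Rightarrow> complex) \<Rightarrow> real \<Rightarrow> bool" where
  "vertical_growth f a \<longleftrightarrow> (\<exists>C. \<forall>\<^sub>F t in at_top. \<forall>s\<in>cball (1/2 + \<i> * of_real t) (1/2).
     log_increment f (1/2 + \<i> * of_real t) (a * ln t) C s)"

lemma vertical_growth_mult:
  assumes "vertical_growth f a" "vertical_growth g b"
  shows "vertical_growth (\<lambda>s. f s * g s) (a + b)"
proof -
  obtain C where C: "\<forall>\<^sub>F t in at_top. \<forall>s\<in>cball (1/2 + \<i> * of_real t) (1/2).
     log_increment f (1/2 + \<i> * of_real t) (a * ln t) C s"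
    using assms unfolding vertical_growth_def by blast
  obtain D where D: "\<forall>\<^sub>F t in at_top. \<forall>s\<in>cball (1/2 + \<i> * of_real t) (1/2).
     log_increment g (1/2 + \<i> * of_real t) (b * ln t) D s"
    using assms unfolding vertical_growth_def by blast
  show ?thesis
    unfolding vertical_growth_def
  proof (rule exI[of _ "C + D"], use C D in eventually_elim)
    case (elim t)
    then show ?case
      unfolding distrib_right by (blast intro: log_increment_mult)
  qed
qed

lemma vertical_growth_inverse:
  assumes "vertical_growth f a"
  shows "vertical_growth (\<lambda>s. inverse (f s)) (- a)"
proof -
  obtain C where "\<forall>\<^sub>F t in at_top. \<forall>s\<in>cball (1/2 + \<i> * of_real t) (1/2).
     log_increment f (1/2 + \<i> * of_real t) (a * ln t) C s"
    using assms unfolding vertical_growth_def by blast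
  then have "\<forall>\<^sub>F t in at_top. \<forall>s\<in>cball (1/2 + \<i> * of_real t) (1/2).
     log_increment (\<lambda>s. inverse (f s)) (1/2 + \<i> * of_real t) (- (a * ln t)) C s"
    by eventually_elim (blast intro: log_increment_inverse)
  then show ?thesis
    unfolding vertical_growth_def minus_mult_left by blast
qed

lemma vertical_growth_const: "vertical_growth (\<lambda>_. c) 0"
  unfolding vertical_growth_def log_increment_def
  by (rule exI[of _ 0]) (auto intro!: always_eventually exI[of _ "0::complex"])

lemma vertical_growth_divide:
  assumes "vertical_growth f a" "vertical_growth g b"
  shows "vertical_growth (\<lambda>s. f s / g s) (a - b)"
  using vertical_growth_mult[OF assms(1) vertical_growth_inverse[OF assms(2)]]
  by (simp add: divide_inverse)

lemma vertical_growth_prod: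
  assumes "\<And>i. i \<in> I \<Longrightarrow> vertical_growth (f i) (a i)"
  shows "vertical_growth (\<lambda>s. \<Prod>i\<in>I. f i s) (\<Sum>i\<in>I. a i)"
  using assms
proof (induction I rule: infinite_finite_induct)
  case (insert i I)
  then show ?case by (simp add: vertical_growth_mult)
qed (simp_all add: vertical_growth_const)

lemma vertical_growth_powr:
  assumes "Q > 0"
  shows "vertical_growth (\<lambda>s. of_real Q powr (1 - 2 * s)) 0"
  unfolding vertical_growth_def log_increment_def
proof (rule exI[of _ "2 * \<bar>ln Q\<bar>"], rule always_eventually, intro allI ballI)
  fix t s
  let ?h = "s - (1/2 + \<i> * of_real t)"
  let ?E = "- 2 * ?h * of_real (ln Q)"
  have "cmod ?E = 2 * \<bar>ln Q\<bar> * cmod ?h"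
    by (simp only: norm_mult norm_minus_cancel norm_numeral norm_of_real mult_ac)
  then have "cmod ?E \<le> 2 * \<bar>ln Q\<bar> * cmod ?h"
    by simp
  moreover have "complex_of_real Q powr (1 - 2 * s) = of_real Q powr (1 - 2 * (1/2 + \<i> * of_real t)) * exp ?E"
    using assms by (simp add: powr_def Ln_of_real algebra_simps flip: exp_add)
  ultimately show "\<exists>E. cmod E \<le> 2 * \<bar>ln Q\<bar> * cmod ?h \<and> complex_of_real Q powr (1 - 2 * s) =
      of_real Q powr (1 - 2 * (1/2 + \<i> * of_real t)) * exp (of_real (0 * ln t) * ?h + E)"
    by (intro exI[of _ ?E]) simp
qed

text \<open>
  The logarithmic derivative of \<open>Gamma (l s + m)\<close> is \<open>l\<close> times a digamma value, and the latter is
  \<open>ln t + O(1)\<close> at height \<open>t\<close>; the mean value inequality for \<open>ln_Gamma\<close> integrates this. Both signs of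
  \<open>l\<close> are needed: \<open>l > 0\<close> for the denominators of \<open>Delta\<close> and \<open>l < 0\<close> for its numerators, where the
  argument contains \<open>1 - s\<close>.
\<close>

lemma vertical_growth_Gamma:
  fixes l :: real and m :: complex
  assumes "l \<noteq> 0"
  shows "vertical_growth (\<lambda>s. Gamma (of_real l * s + m)) l"
proof -
  define A where "A = \<bar>l\<bar> + \<bar>Re m\<bar>"
  obtain C where C: "\<And>w :: complex. \<bar>Re w\<bar> \<le> A \<Longrightarrow> 1 \<le> \<bar>Im w\<bar> \<Longrightarrow> cmod (Digamma w - of_real (ln \<bar>Im w\<bar>)) \<le> C"
    using Digamma_minus_ln_Im_bound[of A] by blast
  \<comment> \<open>At height about \<open>t\<close>, the modulus of \<open>Im (l s + m)\<close> lies between \<open>\<bar>l\<bar> t / 2\<close> and \<open>2 \<bar>l\<bar> t\<close>,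
    so its logarithm is within \<open>K\<close> of \<open>ln t\<close>.\<close>
  define K where "K = \<bar>ln (\<bar>l\<bar> / 2)\<bar> + \<bar>ln (2 * \<bar>l\<bar>)\<bar>"
  have "\<forall>\<^sub>F t in at_top. t \<ge> 1 \<and> \<bar>l\<bar> * t / 2 \<ge> \<bar>l\<bar> / 2 + \<bar>Im m\<bar> \<and> \<bar>l\<bar> * t / 2 \<ge> 1"
    by (intro eventually_conj) (use assms in real_asymp)+
  then have "\<forall>\<^sub>F t in at_top. \<forall>s\<in>cball (1/2 + \<i> * of_real t) (1/2).
     log_increment (\<lambda>s. Gamma (of_real l * s + m)) (1/2 + \<i> * of_real t) (l * ln t) (\<bar>l\<bar> * (C + K)) s"
  proof eventually_elim
    case (elim t)
    let ?s0 = "1/2 + \<i> * complex_of_real t"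
    let ?B = "cball ?s0 (1/2)"
    have key: "1 \<le> \<bar>Im (of_real l * s + m)\<bar> \<and> cmod (Digamma (of_real l * s + m) - of_real (ln t)) \<le> C + K"
      if "s \<in> ?B" for s
    proof -
      have d: "cmod (s - ?s0) \<le> 1/2"
        using that by (simp add: dist_norm norm_minus_commute)
      have re: "\<bar>Re s - 1/2\<bar> \<le> 1/2" and im: "\<bar>Im s - t\<bar> \<le> 1/2"
        using abs_Re_le_cmod[of "s - ?s0"] abs_Im_le_cmod[of "s - ?s0"] d by auto
      have "\<bar>l * (Im s - t)\<bar> \<le> \<bar>l\<bar> * (1/2)"
        unfolding abs_mult by (intro mult_left_mono im) auto
      then have dl: "\<bar>l * Im s - l * t\<bar> \<le> \<bar>l\<bar> / 2" by (simp add: algebra_simps)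
      have lt: "\<bar>l * t\<bar> = \<bar>l\<bar> * t" using elim by (simp add: abs_mult)
      have Im_eq: "Im (of_real l * s + m) = l * Im s + Im m" by simp
      have lo: "\<bar>Im (of_real l * s + m)\<bar> \<ge> \<bar>l\<bar> / 2 * t"
        and hi: "\<bar>Im (of_real l * s + m)\<bar> \<le> 2 * \<bar>l\<bar> * t"
        unfolding Im_eq using dl lt elim by linarith+
      have one: "1 \<le> \<bar>Im (of_real l * s + m)\<bar>" using lo elim by simp
      have "\<bar>Re s\<bar> \<le> 1" using re by linarith
      then have "\<bar>l * Re s\<bar> \<le> \<bar>l\<bar>" by (simp add: abs_mult mult_left_le)
      then have "\<bar>Re (of_real l * s + m)\<bar> \<le> A" unfolding A_def by simp
      then have c: "cmod (Digamma (of_real l * s + m) - of_real (ln \<bar>Im (of_real l * s + m)\<bar>)) \<le> C"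
        using C one by blast
      have "ln (\<bar>l\<bar> / 2 * t) \<le> ln \<bar>Im (of_real l * s + m)\<bar>"
        by (rule ln_mono) (use assms lo elim in auto)
      moreover have "ln (\<bar>l\<bar> / 2 * t) = ln (\<bar>l\<bar> / 2) + ln t"
        using assms elim by (intro ln_mult_pos) auto
      moreover have "ln \<bar>Im (of_real l * s + m)\<bar> \<le> ln (2 * \<bar>l\<bar> * t)"
        by (rule ln_mono) (use assms hi one elim in auto)
      moreover have "ln (2 * \<bar>l\<bar> * t) = ln (2 * \<bar>l\<bar>) + ln t"
        using assms elim by (intro ln_mult_pos) auto
      ultimately have "\<bar>ln \<bar>Im (of_real l * s + m)\<bar> - ln t\<bar> \<le> K"
        unfolding K_def by linarith
      then have "cmod (of_real (ln \<bar>Im (of_real l * s + m)\<bar>) - of_real (ln t)) \<le> K"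
        by (simp flip: of_real_diff)
      with c one show ?thesis
        using norm_triangle_ineq[of "Digamma (of_real l * s + m) - of_real (ln \<bar>Im (of_real l * s + m)\<bar>)"
            "of_real (ln \<bar>Im (of_real l * s + m)\<bar>) - of_real (ln t)"] by simp
    qed
    let ?H = "\<lambda>s. ln_Gamma (of_real l * s + m) - of_real (l * ln t) * s"
    have exp_ln: "Gamma (of_real l * z + m) = exp (ln_Gamma (of_real l * z + m))" if "z \<in> ?B" for z
    proof -
      have "of_real l * z + m \<notin> \<int>\<^sub>\<le>\<^sub>0"
        using key[OF that] by (intro Im_nonzero_imp_notin_nonpos_Ints) auto
      then show ?thesis by (simp add: Gamma_complex_altdef)
    qed
    show ?case
    proof (intro ballI)
      fix s assume s: "s \<in> ?B"
      have "cmod (?H s - ?H ?s0) \<le> \<bar>l\<bar> * (C + K) * cmod (s - ?s0)"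
      proof (rule field_differentiable_bound[of ?B])
        fix z assume z: "z \<in> ?B"
        have "of_real l * z + m \<notin> \<real>\<^sub>\<le>\<^sub>0"
          using key[OF z] by (auto simp: complex_nonpos_Reals_iff)
        then show "(?H has_field_derivative of_real l * (Digamma (of_real l * z + m) - of_real (ln t)))
            (at z within ?B)"
          by (auto intro!: derivative_eq_intros simp: algebra_simps)
        show "cmod (of_real l * (Digamma (of_real l * z + m) - of_real (ln t))) \<le> \<bar>l\<bar> * (C + K)"
          using key[OF z] by (simp add: norm_mult mult_left_mono)
      qed (use s in auto)
      moreover have "Gamma (of_real l * s + m) = Gamma (of_real l * ?s0 + m) *
          exp (of_real (l * ln t) * (s - ?s0) + (?H s - ?H ?s0))"
        unfolding exp_ln[OF s] exp_ln[of ?s0, simplified] exp_add[symmetric]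
        by (simp add: algebra_simps)
      ultimately show "log_increment (\<lambda>s. Gamma (of_real l * s + m)) ?s0 (l * ln t) (\<bar>l\<bar> * (C + K)) s"
        unfolding log_increment_def by blast
    qed
  qed
  then show ?thesis
    unfolding vertical_growth_def by blast
qed

text \<open>
  Numerator and denominator of each Gamma quotient both contribute \<open>- \<lambda>\<^sub>j\<close>, and the power of \<open>Q\<close>
  contributes only to the bounded error term.
\<close>

lemma vertical_growth_Delta:
  assumes "admissible p"
  shows "vertical_growth (Delta p) (- param_degree p)"
proof -
  have "vertical_growth (Delta p) (0 + 0 + (\<Sum>j = 1..fe_num p. - fe_lam p j - fe_lam p j))"
    unfolding Delta_def [abs_def]
  proof (intro vertical_growth_mult vertical_growth_const vertical_growth_prod vertical_growth_divide)
    show "vertical_growth (\<lambda>s. complex_of_real (fe_Q p) powr (1 - 2 * s)) 0"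
      using assms by (intro vertical_growth_powr) (auto simp: admissible_def)
    fix j assume "j \<in> {1..fe_num p}"
    then have "fe_lam p j > 0" using assms unfolding admissible_def by blast
    then have j: "fe_lam p j \<noteq> 0" by simp
    then show "vertical_growth (\<lambda>s. Gamma (complex_of_real (fe_lam p j) * s + fe_mu p j)) (fe_lam p j)"
      by (rule vertical_growth_Gamma)
    show "vertical_growth (\<lambda>s. Gamma (complex_of_real (fe_lam p j) * (1 - s) + cnj (fe_mu p j))) (- fe_lam p j)"
      using vertical_growth_Gamma[of "- fe_lam p j" "of_real (fe_lam p j) + cnj (fe_mu p j)"] j
      by (simp add: algebra_simps)
  qed
  also have "0 + 0 + (\<Sum>j = 1..fe_num p. - fe_lam p j - fe_lam p j) = - param_degree p"
    by (simp add: param_degree_def sum_distrib_left sum_negf)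
  finally show ?thesis .
qed

text \<open>
  For \<open>s = 1/2 + i t\<close> one has \<open>1 - s = cnj s\<close>, so each Gamma quotient is of the form \<open>cnj w / w\<close>
  with a Gamma value \<open>w\<close>.
  The restriction to large \<open>t\<close> avoids the poles of the Gamma function.
\<close>

lemma norm_Delta_critical_line:
  assumes "admissible p"
  shows "\<forall>\<^sub>F t in at_top. cmod (Delta p (1/2 + \<i> * of_real t)) = 1"
proof -
  have "\<forall>\<^sub>F t in at_top. \<forall>j\<in>{1..fe_num p}. 0 < fe_lam p j * t + Im (fe_mu p j)"
  proof (intro eventually_ball_finite ballI)
    fix j assume "j \<in> {1..fe_num p}"
    then have "fe_lam p j > 0" using assms by (auto simp: admissible_def)
    then show "\<forall>\<^sub>F t in at_top. 0 < fe_lam p j * t + Im (fe_mu p j)" by real_asymp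
  qed auto
  then show ?thesis
  proof eventually_elim
    case (elim t)
    let ?s = "1/2 + \<i> * complex_of_real t"
    have "cmod (Gamma (of_real (fe_lam p j) * (1 - ?s) + cnj (fe_mu p j)) /
        Gamma (of_real (fe_lam p j) * ?s + fe_mu p j)) = 1" if "j \<in> {1..fe_num p}" for j
    proof -
      have "cnj (of_real (fe_lam p j) * ?s + fe_mu p j) = of_real (fe_lam p j) * (1 - ?s) + cnj (fe_mu p j)"
        by (simp add: algebra_simps complex_eq_iff)
      then have "Gamma (of_real (fe_lam p j) * (1 - ?s) + cnj (fe_mu p j)) =
          cnj (Gamma (of_real (fe_lam p j) * ?s + fe_mu p j))"
        by (simp add: cnj_Gamma)
      moreover have "of_real (fe_lam p j) * ?s + fe_mu p j \<notin> \<int>\<^sub>\<le>\<^sub>0"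
        using elim that by (intro Im_nonzero_imp_notin_nonpos_Ints) fastforce
      then have "Gamma (of_real (fe_lam p j) * ?s + fe_mu p j) \<noteq> 0"
        by (simp add: Gamma_eq_zero_iff)
      ultimately show ?thesis by (simp add: norm_divide)
    qed
    moreover have "cmod (complex_of_real (fe_Q p) powr (1 - 2 * ?s)) = 1"
      using assms by (auto simp: admissible_def powr_def Ln_of_real)
    ultimately show ?case
      using assms unfolding Delta_def by (simp add: norm_mult admissible_def flip: prod_norm)
  qed
qed

text \<open>
  The only possible singularities are poles of Gamma factors, and there the argument of the factor is
  real. This happens at finitely many heights.
\<close>

lemma isCont_Delta:
  assumes "admissible p"
  shows "\<forall>\<^sub>F t in at_top. \<forall>s. Im s \<ge> t \<longrightarrow> isCont (Delta p) s"
proof -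
  have "\<forall>\<^sub>F t in at_top. \<forall>j\<in>{1..fe_num p}. 0 < fe_lam p j * t + Im (fe_mu p j)"
  proof (intro eventually_ball_finite ballI)
    fix j assume "j \<in> {1..fe_num p}"
    then have "fe_lam p j > 0" using assms by (auto simp: admissible_def)
    then show "\<forall>\<^sub>F t in at_top. 0 < fe_lam p j * t + Im (fe_mu p j)" by real_asymp
  qed auto
  moreover have "isCont (Delta p) s"
    if t: "\<forall>j\<in>{1..fe_num p}. 0 < fe_lam p j * t + Im (fe_mu p j)" and st: "t \<le> Im s" for s t
  proof -
    have "of_real (fe_lam p j) * s + fe_mu p j \<notin> \<int>\<^sub>\<le>\<^sub>0"
      "of_real (fe_lam p j) * (1 - s) + cnj (fe_mu p j) \<notin> \<int>\<^sub>\<le>\<^sub>0" if j: "j \<in> {1..fe_num p}" for j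
    proof -
      have "fe_lam p j > 0" using assms j by (auto simp: admissible_def)
      then have "fe_lam p j * t \<le> fe_lam p j * Im s" using st by simp
      then have "fe_lam p j * Im s + Im (fe_mu p j) > 0" using t j by fastforce
      then show "of_real (fe_lam p j) * s + fe_mu p j \<notin> \<int>\<^sub>\<le>\<^sub>0"
        "of_real (fe_lam p j) * (1 - s) + cnj (fe_mu p j) \<notin> \<int>\<^sub>\<le>\<^sub>0"
        by (auto intro!: Im_nonzero_imp_notin_nonpos_Ints)
    qed
    then have "isCont (\<lambda>s. Gamma (of_real (fe_lam p j) * (1 - s) + cnj (fe_mu p j)) /
        Gamma (of_real (fe_lam p j) * s + fe_mu p j)) s" if "j \<in> {1..fe_num p}" for j
      using that by (intro isCont_divide isCont_Gamma) (auto simp: Gamma_eq_zero_iff)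
    then have "isCont (\<lambda>s. \<Prod>j = 1..fe_num p. Gamma (of_real (fe_lam p j) * (1 - s) + cnj (fe_mu p j)) /
        Gamma (of_real (fe_lam p j) * s + fe_mu p j)) s"
      unfolding isCont_def by (intro tendsto_prod) auto
    moreover have "isCont (\<lambda>s. complex_of_real (fe_Q p) powr (1 - 2 * s)) s"
      using assms by (simp add: powr_def admissible_def)
    ultimately show ?thesis
      unfolding Delta_def [abs_def] by (intro isCont_mult continuous_const)
  qed
  ultimately show ?thesis
    by (auto elim!: eventually_mono)
qed

section \<open>Geometry of the chordal metric\<close>

lemma dist_Fin_Fin: "dist (Fin z) (Fin w) = 2 * cmod (z - w) / (sqrt (1 + (cmod z)\<^sup>2) * sqrt (1 + (cmod w)\<^sup>2))"
  and dist_Fin_Infty: "dist (Fin z) Infty = 2 / sqrt (1 + (cmod z)\<^sup>2)"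
  and dist_Infty_Fin: "dist Infty (Fin z) = 2 / sqrt (1 + (cmod z)\<^sup>2)"
  by (simp_all add: dist_riemann_sphere_def)

text \<open>
  On every disc around \<open>0\<close> the chordal distance is equivalent to the Euclidean one. This lemma is one
  half of the comparison, and \<open>norm_diff_le_dist_Fin\<close> is the other half; staying in a disc is the same as
  keeping a positive chordal distance from \<open>Infty\<close>, by \<open>norm_le_of_dist_Infty_ge\<close>.
\<close>

lemma dist_Fin_Fin_le: "dist (Fin z) (Fin w) \<le> 2 * cmod (z - w)"
proof -
  have "1 * 1 \<le> sqrt (1 + (cmod z)\<^sup>2) * sqrt (1 + (cmod w)\<^sup>2)"
    by (intro mult_mono) auto
  then have "2 * cmod (z - w) * 1 \<le> 2 * cmod (z - w) * (sqrt (1 + (cmod z)\<^sup>2) * sqrt (1 + (cmod w)\<^sup>2))"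
    by (intro mult_left_mono) auto
  then show ?thesis
    unfolding dist_Fin_Fin by (subst pos_divide_le_eq) (simp_all add: one_plus_sq_pos)
qed

lemma norm_le_of_dist_Infty_ge:
  assumes "\<delta> > 0" "\<delta> \<le> dist (Fin w) Infty"
  shows "cmod w \<le> 2 / \<delta>"
proof -
  have "sqrt (1 + (cmod w)\<^sup>2) > 0"
    by (simp add: one_plus_sq_pos)
  then have "sqrt (1 + (cmod w)\<^sup>2) \<le> 2 / \<delta>"
    using assms by (simp add: dist_Fin_Infty field_simps)
  moreover have "cmod w \<le> sqrt (1 + (cmod w)\<^sup>2)"
    by (rule real_le_rsqrt) simp
  ultimately show ?thesis by linarith
qed

lemma norm_diff_le_dist_Fin:
  assumes "cmod z \<le> M" "cmod w \<le> M"
  shows "cmod (z - w) \<le> (1 + M\<^sup>2) * dist (Fin z) (Fin w)"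
proof -
  let ?a = "sqrt (1 + (cmod z)\<^sup>2)" and ?b = "sqrt (1 + (cmod w)\<^sup>2)"
  have pos: "?a > 0" "?b > 0"
    by (simp_all add: one_plus_sq_pos)
  have "?a * ?b \<le> sqrt (1 + M\<^sup>2) * sqrt (1 + M\<^sup>2)"
    using assms pos by (intro mult_mono real_sqrt_le_mono add_left_mono power_mono) auto
  also have "\<dots> = 1 + M\<^sup>2" by simp
  finally have "(?a * ?b) * dist (Fin z) (Fin w) \<le> (1 + M\<^sup>2) * dist (Fin z) (Fin w)"
    by (intro mult_right_mono) auto
  moreover have "(?a * ?b) * dist (Fin z) (Fin w) = 2 * cmod (z - w)"
    using pos by (simp add: dist_Fin_Fin)
  ultimately show ?thesis by (smt (verit) norm_ge_zero)
qed

text \<open>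
  The value \<open>0\<close> at infinity agrees with the convention that a nicely meromorphic function vanishes
  at its poles.
\<close>

definition affine_value :: "riemann_sphere \<Rightarrow> complex" where
  "affine_value x = (case x of Fin w \<Rightarrow> w | Infty \<Rightarrow> 0)"

lemma affine_value_simps [simp]: "affine_value (Fin w) = w" "affine_value Infty = 0"
  by (simp_all add: affine_value_def)

lemma Fin_affine_value: "x \<noteq> Infty \<Longrightarrow> Fin (affine_value x) = x"
  by (cases x) auto

text \<open>
  The inversion \<open>z \<mapsto> 1 / z\<close> of the sphere, which is a rotation and hence an isometry. It carries
  statements about a neighbourhood of \<open>0\<close> to statements about a neighbourhood of infinity.
\<close>

definition sphere_inverse :: "riemann_sphere \<Rightarrow> riemann_sphere" where
  "sphere_inverse x = (if x = Fin 0 then Infty else Fin (inverse (affine_value x)))"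

lemma dist_sphere_inverse: "dist (sphere_inverse x) (sphere_inverse y) = dist x y"
proof -
  have s: "sqrt (1 + (cmod (inverse z))\<^sup>2) = sqrt (1 + (cmod z)\<^sup>2) / cmod z" if "z \<noteq> 0" for z
  proof -
    have "1 + (cmod (inverse z))\<^sup>2 = (1 + (cmod z)\<^sup>2) / (cmod z)\<^sup>2"
      using that by (simp add: norm_inverse power_inverse add_divide_distrib flip: inverse_eq_divide)
    then show ?thesis by (simp add: real_sqrt_divide)
  qed
  have FF: "dist (Fin (inverse z)) (Fin (inverse w)) = dist (Fin z) (Fin w)" if "z \<noteq> 0" "w \<noteq> 0" for z w
  proof -
    have "cmod (inverse z - inverse w) = cmod (z - w) / (cmod z * cmod w)"
      using that by (simp add: inverse_diff_inverse norm_mult norm_inverse norm_minus_commute divide_inverse)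
    then show ?thesis
      using that unfolding dist_Fin_Fin s[OF that(1)] s[OF that(2)] by simp
  qed
  have FI: "dist (Fin (inverse z)) (Fin 0) = dist (Fin z) Infty" if "z \<noteq> 0" for z
    using that unfolding dist_Fin_Fin dist_Fin_Infty s[OF that] by (simp add: norm_inverse)
  have IF: "dist (Fin (inverse z)) Infty = dist (Fin z) (Fin 0)" if "z \<noteq> 0" for z
    using that unfolding dist_Fin_Fin dist_Fin_Infty s[OF that] by simp
  note FI' = FI[unfolded dist_commute[of _ "Fin 0"] dist_commute[of _ Infty]]
  note IF' = IF[unfolded dist_commute[of _ "Fin 0"] dist_commute[of _ Infty]]
  have I0: "dist (Fin 0) Infty = 2" "dist Infty (Fin 0) = 2"
    by (simp_all add: dist_Fin_Infty dist_Infty_Fin)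
  show ?thesis
    by (cases x; cases y) (simp_all add: sphere_inverse_def FF FI IF FI' IF' I0)
qed

lemma affine_value_sphere_inverse: "affine_value (sphere_inverse x) = inverse (affine_value x)"
  by (auto simp: sphere_inverse_def)

section \<open>Chordal limits of meromorphic functions\<close>

lemma isCont_to_sphere:
  assumes f: "f nicely_meromorphic_on A" and "z \<in> A"
  shows "isCont (to_sphere f) z"
proof (cases "is_pole f z")
  case True
  have "filterlim (\<lambda>w. cmod (f w)) at_top (at z)"
    using True unfolding is_pole_def by (rule filterlim_at_infinity_imp_norm_at_top)
  moreover have "((\<lambda>x. 2 / sqrt (1 + x\<^sup>2)) \<longlongrightarrow> 0) at_top"
    by real_asymp
  ultimately have "((\<lambda>w. 2 / sqrt (1 + (cmod (f w))\<^sup>2)) \<longlongrightarrow> 0) (at z)"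
    by (rule filterlim_compose[rotated])
  moreover have "dist (to_sphere f w) Infty \<le> 2 / sqrt (1 + (cmod (f w))\<^sup>2)" for w
    by (simp add: to_sphere_def dist_Fin_Infty)
  ultimately have "((\<lambda>w. dist (to_sphere f w) Infty) \<longlongrightarrow> 0) (at z)"
    using Lim_null_comparison[of "\<lambda>w. dist (to_sphere f w) Infty" "\<lambda>w. 2 / sqrt (1 + (cmod (f w))\<^sup>2)" "at z"]
    by simp
  then show ?thesis
    using True unfolding isCont_def by (subst tendsto_dist_iff) (simp add: to_sphere_def)
next
  case False
  then have an: "f analytic_on {z}"
    using nicely_meromorphic_on_imp_analytic_at[OF f] assms by blast
  then obtain e where e: "e > 0" "f holomorphic_on ball z e"
    by (auto simp: analytic_at_ball)
  then have "\<forall>\<^sub>F w in at z. w \<in> ball z e"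
    by (intro eventually_at_in_open') auto
  then have "\<forall>\<^sub>F w in at z. dist (to_sphere f w) (Fin (f z)) \<le> 2 * cmod (f w - f z)"
  proof eventually_elim
    case (elim w)
    have "f analytic_on {w}"
      unfolding analytic_at using e elim by (intro exI[of _ "ball z e"]) auto
    then show ?case
      by (simp add: to_sphere_def analytic_at_imp_no_pole dist_Fin_Fin_le)
  qed
  moreover have "((\<lambda>w. 2 * cmod (f w - f z)) \<longlongrightarrow> 2 * cmod (f z - f z)) (at z)"
    using analytic_at_imp_isCont[OF an] unfolding isCont_def
    by (intro tendsto_mult tendsto_norm tendsto_diff tendsto_const)
  ultimately have "((\<lambda>w. dist (to_sphere f w) (Fin (f z))) \<longlongrightarrow> 0) (at z)"
    using Lim_null_comparison[of "\<lambda>w. dist (to_sphere f w) (Fin (f z))" "\<lambda>w. 2 * cmod (f w - f z)" "at z"]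
    by simp
  then show ?thesis
    using False unfolding isCont_def by (subst tendsto_dist_iff) (simp add: to_sphere_def)
qed

lemma isCont_locally_uniform_limit:
  assumes "open S" and F: "\<And>k. F k nicely_meromorphic_on S"
    and lim: "locally_uniform_limit S (\<lambda>k. to_sphere (F k)) g" and "z \<in> S"
  shows "isCont g z"
proof -
  obtain r where r: "r > 0" "cball z r \<subseteq> S"
    using assms open_contains_cball by blast
  have "continuous_on (cball z r) g"
  proof (rule uniform_limit_theorem)
    show "\<forall>\<^sub>F k in sequentially. continuous_on (cball z r) (to_sphere (F k))"
    proof (intro always_eventually allI continuous_at_imp_continuous_on ballI)
      fix k w assume "w \<in> cball z r"
      then show "isCont (to_sphere (F k)) w"
        using r by (intro isCont_to_sphere[OF F]) auto
    qed
    show "uniform_limit (cball z r) (\<lambda>k. to_sphere (F k)) g sequentially"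
      using lim r unfolding locally_uniform_limit_def by auto
  qed auto
  then show ?thesis
    by (rule continuous_on_interior) (use r in auto)
qed

text \<open>
  A limit function bounded away from infinity is approximated by functions that are eventually
  bounded, hence free of poles. For these, chordal and Euclidean uniform convergence coincide, and the
  Weierstrass convergence theorem applies.
\<close>

lemma affine_value_limit_holomorphic:
  assumes F: "\<forall>\<^sub>F k in sequentially. F k nicely_meromorphic_on cball z r"
    and lim: "uniform_limit (cball z r) (\<lambda>k. to_sphere (F k)) g sequentially"
    and \<delta>: "\<delta> > 0" "\<And>w. w \<in> cball z r \<Longrightarrow> \<delta> \<le> dist (g w) Infty"
  shows "(\<lambda>w. affine_value (g w)) holomorphic_on ball z r"
proof -
  \<comment> \<open>A chordal distance of at least \<open>\<delta> / 2\<close> from infinity means an absolute value of at most \<open>M\<close>.\<close>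
  define M where "M = 2 / (\<delta> / 2)"
  have M: "M \<ge> 0" using \<delta> by (simp add: M_def)
  have ev: "\<forall>\<^sub>F k in sequentially. (\<forall>w\<in>cball z r. \<not> is_pole (F k) w) \<and> (\<forall>w\<in>cball z r.
      cmod (F k w - affine_value (g w)) \<le> (1 + M\<^sup>2) * dist (to_sphere (F k) w) (g w))"
    using uniform_limitD[OF lim half_gt_zero[OF \<delta>(1)]]
  proof eventually_elim
    case (elim k)
    have "\<not> is_pole (F k) w \<and>
        cmod (F k w - affine_value (g w)) \<le> (1 + M\<^sup>2) * dist (to_sphere (F k) w) (g w)"
      if w: "w \<in> cball z r" for w
    proof -
      have far: "\<delta> / 2 \<le> dist (to_sphere (F k) w) Infty" "\<delta> / 2 \<le> dist (g w) Infty"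
        using bspec[OF elim w] \<delta>(2)[OF w] dist_triangle[of "g w" Infty "to_sphere (F k) w"] \<delta>(1)
        by (auto simp: dist_commute)
      then have np: "\<not> is_pole (F k) w"
        using \<delta>(1) by (auto simp: to_sphere_def)
      have gw: "g w = Fin (affine_value (g w))"
        using far(2) \<delta>(1) by (intro Fin_affine_value[symmetric]) auto
      have "cmod (F k w) \<le> M" "cmod (affine_value (g w)) \<le> M"
        using norm_le_of_dist_Infty_ge[OF half_gt_zero[OF \<delta>(1)]] far np gw
        unfolding M_def to_sphere_def by metis+
      then have "cmod (F k w - affine_value (g w)) \<le> (1 + M\<^sup>2) * dist (Fin (F k w)) (Fin (affine_value (g w)))"
        by (rule norm_diff_le_dist_Fin)
      then show ?thesis
        using np gw by (simp add: to_sphere_def)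
    qed
    then show ?case by blast
  qed
  have "\<forall>\<^sub>F k in sequentially. continuous_on (cball z r) (F k) \<and> F k holomorphic_on ball z r"
    using ev F
  proof eventually_elim
    case (elim k)
    then have "F k analytic_on cball z r"
      by (intro nicely_meromorphic_without_singularities) auto
    then show ?case
      using analytic_imp_holomorphic holomorphic_on_imp_continuous_on holomorphic_on_subset ball_subset_cball
      by blast
  qed
  moreover have "uniform_limit (cball z r) F (\<lambda>w. affine_value (g w)) sequentially"
  proof (rule uniform_limitI)
    fix e :: real assume e: "e > 0"
    have pos: "1 + M\<^sup>2 > 0" by (simp add: add_pos_nonneg)
    then have "e / (1 + M\<^sup>2) > 0" using e by simp
    from uniform_limitD[OF lim this] ev
    show "\<forall>\<^sub>F k in sequentially. \<forall>w\<in>cball z r. dist (F k w) (affine_value (g w)) < e"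
    proof eventually_elim
      case (elim k)
      show ?case
      proof
        fix w assume w: "w \<in> cball z r"
        have "(1 + M\<^sup>2) * dist (to_sphere (F k) w) (g w) < e"
          using bspec[OF elim(1) w] pos by (simp add: field_simps)
        then show "dist (F k w) (affine_value (g w)) < e"
          using elim(2) w by (fastforce simp: dist_norm)
      qed
    qed
  qed
  ultimately show ?thesis
    using holomorphic_uniform_limit sequentially_bot by blast
qed

lemma to_sphere_inverse:
  assumes f: "f nicely_meromorphic_on A" "w \<in> A" and nz: "to_sphere f w \<noteq> Fin 0"
  shows "to_sphere (\<lambda>z. inverse (f z)) w = sphere_inverse (to_sphere f w)"
proof (cases "is_pole f w")
  case True
  then have "f w = 0"
    using f not_tendsto_and_filterlim_at_infinity[OF trivial_limit_at, of f "f w" w]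
    unfolding nicely_meromorphic_on_def is_pole_def by blast
  moreover have "\<not> is_pole (\<lambda>z. inverse (f z)) w"
    using is_pole_tendsto[OF True] not_tendsto_and_filterlim_at_infinity[OF trivial_limit_at]
    unfolding is_pole_def o_def by blast
  ultimately show ?thesis
    using True by (simp add: to_sphere_def sphere_inverse_def)
next
  case False
  then have "f analytic_on {w}" "f w \<noteq> 0"
    using nicely_meromorphic_on_imp_analytic_at[OF f] nz by (auto simp: to_sphere_def)
  then have "(\<lambda>z. inverse (f z)) analytic_on {w}"
    by (intro analytic_intros) auto
  then show ?thesis
    using False nz by (simp add: to_sphere_def sphere_inverse_def analytic_at_imp_no_pole)
qed

text \<open>
  The counterpart at points where the limit function may be infinite: the inversion turns values
  bounded away from \<open>0\<close> into values bounded away from infinity.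
\<close>

lemma inverse_affine_value_limit_holomorphic:
  assumes F: "\<And>k. F k nicely_meromorphic_on cball z r"
    and lim: "uniform_limit (cball z r) (\<lambda>k. to_sphere (F k)) g sequentially"
    and \<delta>: "\<delta> > 0" "\<And>w. w \<in> cball z r \<Longrightarrow> \<delta> \<le> dist (g w) (Fin 0)"
  shows "(\<lambda>w. inverse (affine_value (g w))) holomorphic_on ball z r"
proof -
  have "(\<lambda>w. affine_value (sphere_inverse (g w))) holomorphic_on ball z r"
  proof (rule affine_value_limit_holomorphic[where F = "\<lambda>k w. inverse (F k w)"])
    show "\<forall>\<^sub>F k in sequentially. (\<lambda>w. inverse (F k w)) nicely_meromorphic_on cball z r"
      using F by (intro always_eventually allI nicely_meromorphic_on_inverse)
    have "uniform_limit (cball z r) (\<lambda>k w. sphere_inverse (to_sphere (F k) w)) (\<lambda>w. sphere_inverse (g w)) sequentially"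
      using lim by (simp add: uniform_limit_iff dist_sphere_inverse)
    moreover have "\<forall>\<^sub>F k in sequentially. \<forall>w\<in>cball z r.
        sphere_inverse (to_sphere (F k) w) = to_sphere (\<lambda>w. inverse (F k w)) w"
      using uniform_limitD[OF lim \<delta>(1)]
    proof eventually_elim
      case (elim k)
      show ?case
      proof
        fix w assume w: "w \<in> cball z r"
        have "to_sphere (F k) w \<noteq> Fin 0"
          using bspec[OF elim w] \<delta>(2)[OF w] by (auto simp: dist_commute)
        then show "sphere_inverse (to_sphere (F k) w) = to_sphere (\<lambda>w. inverse (F k w)) w"
          using to_sphere_inverse[OF F w] by simp
      qed
    qed
    ultimately show "uniform_limit (cball z r) (\<lambda>k. to_sphere (\<lambda>w. inverse (F k w))) (\<lambda>w. sphere_inverse (g w)) sequentially"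
      by (subst uniform_limit_cong) (auto elim!: eventually_mono)
    show "\<delta> \<le> dist (sphere_inverse (g w)) Infty" if "w \<in> cball z r" for w
      using \<delta>(2)[OF that] dist_sphere_inverse[of "g w" "Fin 0"] by (simp add: sphere_inverse_def)
  qed fact
  then show ?thesis
    by (simp add: affine_value_sphere_inverse)
qed

text \<open>
  Every point has a neighbourhood on which the limit \<open>g\<close> or its reciprocal is holomorphic. Hence a
  point with value infinity either has a neighbourhood on which \<open>g\<close> is constantly infinite, or is
  an isolated zero of the reciprocal and thus a pole. The points of the first kind form an
  open and relatively closed set, which is empty or everything because the domain is connected.
\<close>

theorem meromorphic_limit_cases:
  assumes S: "open S" "connected S" and F: "\<And>k. F k nicely_meromorphic_on S"
    and lim: "locally_uniform_limit S (\<lambda>k. to_sphere (F k)) g"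
  obtains "\<forall>z\<in>S. g z = Infty"
  | h where "h nicely_meromorphic_on S" "\<forall>z\<in>S. g z = to_sphere h z"
proof -
  note cont = isCont_locally_uniform_limit[OF S(1) F lim]
  let ?h = "\<lambda>w. affine_value (g w)"
  have far: "\<exists>r>0. cball z r \<subseteq> S \<and> (\<exists>\<delta>>0. \<forall>w\<in>cball z r. \<delta> \<le> dist (g w) c)" if z: "z \<in> S" "g z \<noteq> c" for z c
  proof -
    let ?\<delta> = "dist (g z) c / 2"
    have "?\<delta> > 0" using z by simp
    then have "\<forall>\<^sub>F w in at z. dist (g w) (g z) < ?\<delta>"
      using cont[OF z(1)] unfolding isCont_def by (intro tendstoD)
    then obtain d where d: "d > 0" "\<And>w. w \<noteq> z \<Longrightarrow> dist w z < d \<Longrightarrow> dist (g w) (g z) < ?\<delta>"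
      unfolding eventually_at by auto
    obtain r where r: "r > 0" "cball z r \<subseteq> S"
      using S z open_contains_cball by blast
    have "?\<delta> \<le> dist (g w) c" if "w \<in> cball z (min r (d / 2))" for w
    proof (cases "w = z")
      case False
      then have "dist (g w) (g z) < ?\<delta>"
        using that d by (intro d) (auto simp: dist_commute)
      then show ?thesis
        using dist_triangle[of "g z" c "g w"] by (simp add: dist_commute)
    qed auto
    then show ?thesis
      using r d z \<open>?\<delta> > 0\<close> by (intro exI[of _ "min r (d / 2)"] conjI exI[of _ ?\<delta>] ballI) auto
  qed
  have unif: "uniform_limit (cball z r) (\<lambda>k. to_sphere (F k)) g sequentially" if "cball z r \<subseteq> S" for z r
    using lim that unfolding locally_uniform_limit_def by auto
  have F': "F k nicely_meromorphic_on cball z r" if "cball z r \<subseteq> S" for z r k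
    using F that nicely_meromorphic_on_subset by blast
  have finite_point: "\<exists>r>0. (\<forall>w\<in>ball z r. g w \<noteq> Infty) \<and> ?h holomorphic_on ball z r"
    if z: "z \<in> S" "g z \<noteq> Infty" for z
  proof -
    obtain r \<delta> where r: "r > 0" "cball z r \<subseteq> S" "\<delta> > 0" "\<forall>w\<in>cball z r. \<delta> \<le> dist (g w) Infty"
      using far[OF z] by blast
    have "?h holomorphic_on ball z r"
      by (rule affine_value_limit_holomorphic[OF _ unif[OF r(2)] r(3)]) (use r F' in auto)
    moreover have "g w \<noteq> Infty" if "w \<in> ball z r" for w
      using bspec[OF r(4), of w] that r(3) by auto
    ultimately show ?thesis using r by blast
  qed
  have infinite_point: "\<exists>r>0. (\<lambda>w. inverse (?h w)) holomorphic_on ball z r"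
    if z: "z \<in> S" "g z = Infty" for z
  proof -
    have "g z \<noteq> Fin 0" using z by simp
    then obtain r \<delta> where r: "r > 0" "cball z r \<subseteq> S" "\<delta> > 0" "\<forall>w\<in>cball z r. \<delta> \<le> dist (g w) (Fin 0)"
      using far[OF z(1)] by blast
    have "(\<lambda>w. inverse (?h w)) holomorphic_on ball z r"
      by (rule inverse_affine_value_limit_holomorphic[OF _ unif[OF r(2)] r(3)]) (use r F' in auto)
    then show ?thesis using r by blast
  qed
  define P where "P z \<longleftrightarrow> (\<forall>\<^sub>F w in nhds z. g w = Infty)" for z
  have isolated: "\<forall>\<^sub>F w in at z. g w \<noteq> Infty \<and> inverse (?h w) \<noteq> 0" if z: "z \<in> S" "g z = Infty" "\<not> P z" for z
  proof -
    obtain r where r: "r > 0" "(\<lambda>w. inverse (?h w)) holomorphic_on ball z r"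
      using infinite_point[OF z(1,2)] by blast
    have "\<exists>b\<in>ball z r. inverse (?h b) \<noteq> 0"
    proof (rule ccontr)
      assume "\<not> ?thesis"
      then have zero: "?h b = 0" if "b \<in> ball z r" for b using that by simp
      have "g z \<noteq> Fin 0" using z(2) by simp
      then obtain d \<delta> where d: "d > 0" "\<delta> > 0" "\<forall>w\<in>cball z d. \<delta> \<le> dist (g w) (Fin 0)"
        using far[OF z(1)] by blast
      have nz: "g w \<noteq> Fin 0" if "w \<in> ball z d" for w
        using bspec[OF d(3), of w] that d(2) by auto
      have "\<forall>\<^sub>F w in nhds z. w \<in> ball z r" "\<forall>\<^sub>F w in nhds z. w \<in> ball z d"
        using r(1) d(1) by (auto intro!: eventually_nhds_in_open simp del: mem_ball)
      then have "P z"
        unfolding P_def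
      proof eventually_elim
        case (elim w)
        then show ?case using zero[of w] nz[of w] by (cases "g w") auto
      qed
      then show False using z(3) by simp
    qed
    then obtain b where b: "b \<in> ball z r" "inverse (?h b) \<noteq> 0" by blast
    have z0: "z \<in> ball z r" "inverse (?h z) = 0"
      using z r by auto
    obtain d where d: "0 < d" "ball z d \<subseteq> ball z r"
        "\<And>w. w \<in> ball z d - {z} \<Longrightarrow> inverse (?h w) \<noteq> 0"
      by (rule isolated_zeros[OF r(2) open_ball connected_ball z0 b]) (rule that)
    have "\<forall>\<^sub>F w in at z. w \<in> ball z d - {z}"
      using d(1) by (intro eventually_at_in_open) auto
    then show ?thesis
    proof eventually_elim
      case (elim w)
      then have "inverse (?h w) \<noteq> 0" by (rule d(3))
      then show ?case by auto
    qed
  qed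
  have P_imp: "g z = Infty" if "P z" for z
    using that unfolding P_def by (rule eventually_nhds_x_imp_x)
  \<comment> \<open>The set where \<open>P\<close> fails is open: near an isolated infinity all other values are finite.\<close>
  have ev_not: "\<forall>\<^sub>F w in nhds z. \<not> P w" if z: "z \<in> S" "\<not> P z" for z
  proof (cases "g z = Infty")
    case True
    have "\<forall>\<^sub>F w in at z. \<not> P w"
      using isolated[OF z(1) True z(2)] by eventually_elim (use P_imp in blast)
    then show ?thesis
      using z(2) by (simp add: eventually_nhds_conv_at)
  next
    case False
    then obtain r where r: "r > 0" "\<forall>w\<in>ball z r. g w \<noteq> Infty"
      using finite_point[OF z(1) False] by blast
    then have "\<forall>\<^sub>F w in nhds z. w \<in> ball z r"
      using eventually_nhds_in_open[OF open_ball, of z z r] by simp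
    then show ?thesis
    proof eventually_elim
      case (elim w)
      then show ?case using P_imp[of w] r(2) by auto
    qed
  qed
  have ev_P: "\<forall>\<^sub>F w in nhds z. P w" if "P z" for z
    using that unfolding P_def by (simp add: eventually_eventually)
  have openI: "open T" if nb: "\<And>x. x \<in> T \<Longrightarrow> \<forall>\<^sub>F y in nhds x. y \<in> T" for T :: "complex set"
  proof (subst open_subopen, intro ballI)
    fix x assume "x \<in> T"
    from nb[OF this] obtain U where "open U" "x \<in> U" "\<forall>y\<in>U. y \<in> T"
      unfolding eventually_nhds by blast
    then show "\<exists>U. open U \<and> x \<in> U \<and> U \<subseteq> T"
      by (intro exI[of _ U]) auto
  qed
  have "open {z \<in> S. P z}"
  proof (rule openI)
    fix x assume "x \<in> {z \<in> S. P z}"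
    then have "\<forall>\<^sub>F y in nhds x. P y" "\<forall>\<^sub>F y in nhds x. y \<in> S"
      using ev_P[of x] eventually_nhds_in_open[OF S(1), of x] by simp_all
    then show "\<forall>\<^sub>F y in nhds x. y \<in> {z \<in> S. P z}"
      by eventually_elim simp
  qed
  moreover have "open {z \<in> S. \<not> P z}"
  proof (rule openI)
    fix x assume "x \<in> {z \<in> S. \<not> P z}"
    then have "\<forall>\<^sub>F y in nhds x. \<not> P y" "\<forall>\<^sub>F y in nhds x. y \<in> S"
      using ev_not[of x] eventually_nhds_in_open[OF S(1), of x] by simp_all
    then show "\<forall>\<^sub>F y in nhds x. y \<in> {z \<in> S. \<not> P z}"
      by eventually_elim simp
  qed
  ultimately have "{z \<in> S. P z} \<inter> S = {} \<or> {z \<in> S. \<not> P z} \<inter> S = {}"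
    using S by (intro connectedD) auto
  then consider "\<forall>z\<in>S. P z" | "\<forall>z\<in>S. \<not> P z" by blast
  then show ?thesis
  proof cases
    case 1
    then show ?thesis using P_imp that(1) by blast
  next
    case 2
    have fin: "?h analytic_on {z}" if z: "z \<in> S" "g z \<noteq> Infty" for z
      using finite_point[OF z] by (auto simp: analytic_at_ball)
    have inf: "?h meromorphic_on {z} \<and> is_pole ?h z" if z: "z \<in> S" "g z = Infty" for z
    proof -
      have an: "(\<lambda>w. inverse (?h w)) analytic_on {z}"
        using infinite_point[OF z] by (auto simp: analytic_at_ball)
      then have "(\<lambda>w. inverse (inverse (?h w))) meromorphic_on {z}"
        by (intro meromorphic_intros analytic_on_imp_meromorphic_on)
      moreover have "isolated_zero (\<lambda>w. inverse (?h w)) z"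
        using isolated[OF z] 2 z analytic_at_imp_isCont[OF an]
        by (auto simp: isolated_zero_def isCont_def elim!: eventually_mono)
      then have "is_pole (\<lambda>w. inverse (inverse (?h w))) z"
        by (simp only: is_pole_inverse_iff)
      ultimately show ?thesis by simp
    qed
    have "?h nicely_meromorphic_on S"
      unfolding nicely_meromorphic_on_def meromorphic_on_meromorphic_at[of _ S]
    proof (intro conjI ballI)
      fix z assume "z \<in> S"
      then show "?h meromorphic_on {z}"
        using fin[of z] inf[of z] analytic_on_imp_meromorphic_on by (cases "g z = Infty") auto
      show "is_pole ?h z \<and> ?h z = 0 \<or> ?h \<midarrow>z\<rightarrow> ?h z"
        using \<open>z \<in> S\<close> fin[of z] inf[of z] analytic_at_imp_isCont[of ?h z]
        unfolding isCont_def by (cases "g z = Infty") auto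
    qed
    moreover have "g z = to_sphere ?h z" if z: "z \<in> S" for z
    proof (cases "g z = Infty")
      case True
      then show ?thesis using inf[OF z] by (simp add: to_sphere_def)
    next
      case False
      then show ?thesis
        using analytic_at_imp_no_pole[OF fin[OF z]] by (simp add: to_sphere_def Fin_affine_value)
    qed
    ultimately show ?thesis using that(2) by blast
  qed
qed

section \<open>The rescaled functional equation\<close>

lemma is_pole_affine:
  fixes f :: "complex \<Rightarrow> complex"
  assumes "is_pole f (a + b * z)" "b \<noteq> 0"
  shows "is_pole (\<lambda>w. f (a + b * w)) z"
proof (rule is_pole_compose[OF assms(1)])
  show "(\<lambda>w. a + b * w) \<midarrow>z\<rightarrow> a + b * z"
    by (intro tendsto_intros)
  have "\<forall>\<^sub>F w in at z. w \<noteq> z"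
    by (simp add: eventually_at_filter)
  then show "\<forall>\<^sub>F w in at z. a + b * w \<noteq> a + b * z"
    by eventually_elim (simp add: assms)
qed

lemma nicely_meromorphic_on_affine:
  assumes f: "f nicely_meromorphic_on A" and "b \<noteq> 0"
    and into: "\<And>z. z \<in> B \<Longrightarrow> a + b * z \<in> A"
  shows "(\<lambda>z. f (a + b * z)) nicely_meromorphic_on B"
  unfolding nicely_meromorphic_on_def
proof (intro conjI ballI)
  show "(\<lambda>z. f (a + b * z)) meromorphic_on B"
  proof (rule meromorphic_on_compose[where f = "\<lambda>z. a + b * z" and g = f])
    show "f meromorphic_on A"
      using f by (simp add: nicely_meromorphic_on_def)
    show "(\<lambda>z. a + b * z) analytic_on B"
      by (intro analytic_intros)
  qed (use into in auto)
  fix z assume "z \<in> B"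
  then have z: "a + b * z \<in> A" by (rule into)
  show "is_pole (\<lambda>z. f (a + b * z)) z \<and> f (a + b * z) = 0 \<or>
      (\<lambda>z. f (a + b * z)) \<midarrow>z\<rightarrow> f (a + b * z)"
  proof (cases "is_pole f (a + b * z)")
    case True
    then have "f (a + b * z) = 0"
      using f z not_tendsto_and_filterlim_at_infinity[OF trivial_limit_at, of f "f (a + b * z)" "a + b * z"]
      unfolding nicely_meromorphic_on_def is_pole_def by blast
    then show ?thesis
      using is_pole_affine[OF True \<open>b \<noteq> 0\<close>] by simp
  next
    case False
    have "isCont f (a + b * z)"
      using nicely_meromorphic_on_imp_analytic_at[OF f z False] by (rule analytic_at_imp_isCont)
    then have "isCont (\<lambda>z. f (a + b * z)) z"
      using isCont_o2[where f = "\<lambda>z. a + b * z" and a = z and g = f] by simp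
    then show ?thesis by (simp add: isCont_def)
  qed
qed

text \<open>
  The functional equation is known only off a sparse set; at a point where all functions
  involved are continuous it follows by passing to the limit.
\<close>

lemma functional_equation_off_poles:
  assumes G: "G nicely_meromorphic_on half_strip" and fe: "satisfies_fe G p"
    and s: "s \<in> half_strip" and cont: "isCont (Delta p) s"
    and np: "\<not> is_pole G s" "\<not> is_pole G (1 - cnj s)"
  shows "G s = Delta p s * cnj (G (1 - cnj s))"
proof -
  have s': "1 - cnj s \<in> half_strip"
    using s by (simp add: half_strip_def)
  have "isCont G s" and "isCont G (1 - cnj s)"
    using nicely_meromorphic_on_imp_analytic_at[OF G s np(1)]
      nicely_meromorphic_on_imp_analytic_at[OF G s' np(2)] by (auto intro: analytic_at_imp_isCont)
  have "isCont (\<lambda>s. G (1 - cnj s)) s"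
    using \<open>isCont G (1 - cnj s)\<close> by (rule isCont_o2[rotated]) simp
  then have "isCont (\<lambda>s. Delta p s * cnj (G (1 - cnj s))) s"
    by (intro isCont_mult cont continuous_cnj)
  then have "(\<lambda>s. Delta p s * cnj (G (1 - cnj s))) \<midarrow>s\<rightarrow> Delta p s * cnj (G (1 - cnj s))"
    by (simp add: isCont_def)
  moreover have "\<forall>\<^sub>F s in at s. Delta p s * cnj (G (1 - cnj s)) = G s"
    using eventually_cosparse_imp_eventually_at[OF fe[unfolded satisfies_fe_def] s, of UNIV]
    by eventually_elim simp
  ultimately have "G \<midarrow>s\<rightarrow> Delta p s * cnj (G (1 - cnj s))"
    by (rule Lim_transform_eventually)
  moreover have "G \<midarrow>s\<rightarrow> G s"
    using \<open>isCont G s\<close> by (simp add: isCont_def)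
  ultimately show ?thesis
    by (intro tendsto_unique[OF trivial_limit_at])
qed

lemma rescaling_in_half_strip:
  assumes "0 \<le> r" "r \<le> 1/2" "t \<ge> 2" "cmod z < 1"
  shows "1/2 + of_real r * z + \<i> * of_real t \<in> half_strip"
    and "1/2 + of_real r * z + \<i> * of_real t \<in> cball (1/2 + \<i> * of_real t) (1/2)"
    and "Im (1/2 + of_real r * z + \<i> * of_real t) \<ge> t - 1/2"
proof -
  have b: "r * \<bar>x\<bar> \<le> 1/2 * \<bar>x\<bar>" "0 \<le> r * \<bar>x\<bar>" for x :: real
    using assms mult_right_mono[OF assms(2), of "\<bar>x\<bar>"] by auto
  have "\<bar>r * Re z\<bar> < 1/2" "\<bar>r * Im z\<bar> < 1/2" "r * cmod z \<le> 1/2"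
    using b[of "Re z"] b[of "Im z"] b[of "cmod z"] abs_Re_le_cmod[of z] abs_Im_le_cmod[of z] assms
    by (auto simp: abs_mult)
  then show "1/2 + of_real r * z + \<i> * of_real t \<in> half_strip"
    "1/2 + of_real r * z + \<i> * of_real t \<in> cball (1/2 + \<i> * of_real t) (1/2)"
    "Im (1/2 + of_real r * z + \<i> * of_real t) \<ge> t - 1/2"
    using assms by (auto simp: half_strip_def dist_norm norm_mult norm_minus_commute)
qed

lemma rescaled_nicely_meromorphic:
  assumes G: "G nicely_meromorphic_on half_strip"
    and \<mu>: "0 < \<mu> t" "\<mu> t \<le> ln t / 2" and t: "t \<ge> 2"
  shows "rescaled G \<mu> t nicely_meromorphic_on ball 0 1"
    and "z \<in> ball 0 1 \<Longrightarrow> \<not> is_pole (rescaled G \<mu> t) z \<Longrightarrow>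
      \<not> is_pole G (1/2 + of_real (\<mu> t / ln t) * z + \<i> * of_real t)"
proof -
  let ?r = "\<mu> t / ln t"
  have r: "0 < ?r" "?r \<le> 1/2"
    using \<mu> t by (auto simp: field_simps)
  have eq: "rescaled G \<mu> t = (\<lambda>z. G (1/2 + \<i> * of_real t + of_real ?r * z))"
    by (simp add: rescaled_def add_ac fun_eq_iff)
  have into: "1/2 + \<i> * of_real t + of_real ?r * z \<in> half_strip" if "z \<in> ball 0 1" for z
    using rescaling_in_half_strip(1)[of ?r t z] r t that by (simp add: add_ac)
  show "rescaled G \<mu> t nicely_meromorphic_on ball 0 1"
    unfolding eq using r by (intro nicely_meromorphic_on_affine[OF G _ into]) auto
  show "\<not> is_pole G (1/2 + of_real ?r * z + \<i> * of_real t)"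
    if "z \<in> ball 0 1" "\<not> is_pole (rescaled G \<mu> t) z"
  proof
    assume "is_pole G (1/2 + of_real ?r * z + \<i> * of_real t)"
    then have "is_pole G (1/2 + \<i> * of_real t + of_real ?r * z)"
      by (simp only: add_ac)
    then have "is_pole (\<lambda>z. G (1/2 + \<i> * of_real t + of_real ?r * z)) z"
      by (rule is_pole_affine) (use r in auto)
    then show False using that eq by simp
  qed
qed

text \<open>
  In the rescaled coordinate the reflection \<open>s \<mapsto> 1 - cnj s\<close> becomes \<open>z \<mapsto> - cnj z\<close>. The increment of
  \<open>s\<close> is \<open>\<mu>(t) z / ln t\<close>, and multiplication by the growth rate \<open>- d ln t\<close> of \<open>Delta\<close> leaves the exponent
  \<open>- d \<mu>(t) z\<close>, which is where the three regimes for \<open>\<mu>\<close> come from.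
\<close>

lemma rescaled_functional_equation:
  assumes p: "admissible p" "satisfies_fe G p" and G: "G nicely_meromorphic_on half_strip"
    and \<mu>: "\<And>t. t \<ge> 2 \<Longrightarrow> 0 < \<mu> t \<and> \<mu> t \<le> ln t / 2"
  obtains C where "C \<ge> 0" and "\<forall>\<^sub>F t in at_top. \<forall>z\<in>ball 0 1. \<exists>E. cmod E \<le> C * (\<mu> t / ln t) \<and>
    (\<not> is_pole (rescaled G \<mu> t) z \<longrightarrow> \<not> is_pole (rescaled G \<mu> t) (- cnj z) \<longrightarrow>
     rescaled G \<mu> t z = Delta p (1/2 + \<i> * of_real t) *
       exp (- of_real (param_degree p * \<mu> t) * z + E) * cnj (rescaled G \<mu> t (- cnj z)))"
proof -
  obtain C where C: "\<forall>\<^sub>F t in at_top. \<forall>s\<in>cball (1/2 + \<i> * of_real t) (1/2).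
     log_increment (Delta p) (1/2 + \<i> * of_real t) (- param_degree p * ln t) C s"
    using vertical_growth_Delta[OF p(1)] unfolding vertical_growth_def by blast
  obtain T where T: "\<And>t s. t \<ge> T \<Longrightarrow> t \<le> Im s \<Longrightarrow> isCont (Delta p) s"
    using isCont_Delta[OF p(1)] unfolding eventually_at_top_linorder by blast
  have "\<forall>\<^sub>F t in at_top. \<forall>z\<in>ball 0 1. \<exists>E. cmod E \<le> \<bar>C\<bar> * (\<mu> t / ln t) \<and>
    (\<not> is_pole (rescaled G \<mu> t) z \<longrightarrow> \<not> is_pole (rescaled G \<mu> t) (- cnj z) \<longrightarrow>
     rescaled G \<mu> t z = Delta p (1/2 + \<i> * of_real t) *
       exp (- of_real (param_degree p * \<mu> t) * z + E) * cnj (rescaled G \<mu> t (- cnj z)))"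
    using C eventually_ge_at_top[of "max 2 (T + 1/2)"]
  proof eventually_elim
    case (elim t)
    let ?r = "\<mu> t / ln t"
    have t: "t \<ge> 2" "ln t > 0" and r: "0 < ?r" "?r \<le> 1/2"
      using \<mu>[of t] elim by (auto simp: field_simps)
    show ?case
    proof
      fix z :: complex assume z: "z \<in> ball 0 1"
      let ?s = "1/2 + of_real ?r * z + \<i> * of_real t" and ?c = "1/2 + \<i> * complex_of_real t"
      have s: "?s \<in> half_strip" "?s \<in> cball ?c (1/2)" "Im ?s \<ge> t - 1/2"
        by (rule rescaling_in_half_strip; use r t z in simp)+
      have diff: "?s - ?c = of_real ?r * z" by simp
      obtain E where E: "cmod E \<le> C * cmod (?s - ?c)"
          "Delta p ?s = Delta p ?c * exp (of_real (- param_degree p * ln t) * (?s - ?c) + E)"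
        using elim(1) s(2) unfolding log_increment_def by blast
      have "of_real (- param_degree p * ln t) * (?s - ?c) = - of_real (param_degree p * \<mu> t) * z"
        using t unfolding diff by simp
      then have Delta_s: "Delta p ?s = Delta p ?c * exp (- of_real (param_degree p * \<mu> t) * z + E)"
        using E(2) by simp
      have "cmod E \<le> C * (?r * cmod z)"
        using E(1) unfolding diff norm_mult norm_of_real abs_of_pos[OF r(1)] .
      also have "\<dots> \<le> \<bar>C\<bar> * (?r * 1)"
        using less_imp_le[OF r(1)] z by (intro mult_mono mult_left_mono mult_nonneg_nonneg) auto
      finally have E_bound: "cmod E \<le> \<bar>C\<bar> * ?r" by simp
      have refl: "1 - cnj ?s = 1/2 + of_real ?r * (- cnj z) + \<i> * of_real t"
        by (simp add: complex_eq_iff)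
      have "rescaled G \<mu> t z = Delta p ?c *
          exp (- of_real (param_degree p * \<mu> t) * z + E) * cnj (rescaled G \<mu> t (- cnj z))"
        if np: "\<not> is_pole (rescaled G \<mu> t) z" "\<not> is_pole (rescaled G \<mu> t) (- cnj z)"
      proof -
        have "\<not> is_pole G ?s"
          by (rule rescaled_nicely_meromorphic(2)[OF G _ _ _ z np(1)]) (use \<mu>[of t] t in auto)
        moreover have "\<not> is_pole G (1 - cnj ?s)"
          unfolding refl by (rule rescaled_nicely_meromorphic(2)[OF G _ _ _ _ np(2)]) (use \<mu>[of t] t z in auto)
        ultimately have "G ?s = Delta p ?s * cnj (G (1 - cnj ?s))"
          using T[of "t - 1/2" ?s] elim(2) s(3)
          by (intro functional_equation_off_poles[OF G p(2) s(1)]) auto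
        then show ?thesis
          unfolding Delta_s refl rescaled_def .
      qed
      then show "\<exists>E. cmod E \<le> \<bar>C\<bar> * ?r \<and>
        (\<not> is_pole (rescaled G \<mu> t) z \<longrightarrow> \<not> is_pole (rescaled G \<mu> t) (- cnj z) \<longrightarrow>
         rescaled G \<mu> t z = Delta p ?c *
           exp (- of_real (param_degree p * \<mu> t) * z + E) * cnj (rescaled G \<mu> t (- cnj z)))"
        using E_bound by blast
    qed
  qed
  then show ?thesis
    by (intro that[of "\<bar>C\<bar>"]) auto
qed

section \<open>Passing to the limit\<close>

text \<open>
  Points near \<open>Fin w\<close> keep a positive chordal distance from \<open>Infty\<close>, so they lie in a fixed disc, where
  the chordal distance controls the Euclidean one.
\<close>

lemma tendsto_Fin_imp_tendsto_affine_value: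
  assumes "(x \<longlongrightarrow> Fin w) F"
  shows "((\<lambda>k. affine_value (x k)) \<longlongrightarrow> w) F" and "\<forall>\<^sub>F k in F. x k \<noteq> Infty"
proof -
  let ?\<delta> = "dist (Fin w) Infty / 2"
  define M where "M = 2 / ?\<delta>"
  have \<delta>: "?\<delta> > 0" by simp
  have "\<forall>\<^sub>F k in F. dist (x k) (Fin w) < ?\<delta>"
    using assms \<delta> by (rule tendstoD)
  then have far: "\<forall>\<^sub>F k in F. ?\<delta> \<le> dist (x k) Infty"
  proof eventually_elim
    case (elim k)
    then show ?case using dist_triangle[of "Fin w" Infty "x k"] by (simp add: dist_commute)
  qed
  then show "\<forall>\<^sub>F k in F. x k \<noteq> Infty"
  proof eventually_elim
    case (elim k)
    then show ?case using \<delta> by (metis dist_self not_less)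
  qed
  have bound: "\<forall>\<^sub>F k in F. norm (cmod (affine_value (x k) - w)) \<le> (1 + M\<^sup>2) * dist (x k) (Fin w)"
    using far
  proof eventually_elim
    case (elim k)
    then have x: "x k = Fin (affine_value (x k))"
      using \<delta> by (intro Fin_affine_value[symmetric]) (metis dist_self not_less)
    have "cmod (affine_value (x k)) \<le> M"
      unfolding M_def using elim x by (intro norm_le_of_dist_Infty_ge \<delta>) simp
    moreover have "cmod w \<le> M"
      unfolding M_def using \<delta> by (intro norm_le_of_dist_Infty_ge) auto
    ultimately have "cmod (affine_value (x k) - w) \<le> (1 + M\<^sup>2) * dist (Fin (affine_value (x k))) (Fin w)"
      by (rule norm_diff_le_dist_Fin)
    then show ?case using x by simp
  qed
  have "((\<lambda>k. dist (x k) (Fin w)) \<longlongrightarrow> 0) F"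
    using assms by (subst (asm) tendsto_dist_iff)
  then have "((\<lambda>k. (1 + M\<^sup>2) * dist (x k) (Fin w)) \<longlongrightarrow> (1 + M\<^sup>2) * 0) F"
    by (intro tendsto_mult tendsto_const)
  then have "((\<lambda>k. cmod (affine_value (x k) - w)) \<longlongrightarrow> 0) F"
    using Lim_null_comparison[OF bound] by simp
  then show "((\<lambda>k. affine_value (x k)) \<longlongrightarrow> w) F"
    by (simp add: tendsto_norm_zero_iff LIM_zero_iff)
qed

lemma tendsto_reflection: "filterlim (\<lambda>z. - cnj z) (at (- cnj a)) (at a)"
proof -
  have "((\<lambda>z. - cnj z) \<longlongrightarrow> - cnj a) (at a)"
    by (intro tendsto_minus tendsto_cnj tendsto_ident_at)
  moreover have "\<forall>\<^sub>F z in at a. - cnj z \<noteq> - cnj a"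
    by (simp add: eventually_at_filter)
  ultimately show ?thesis
    by (simp add: filterlim_at)
qed

lemma eventually_no_pole_and_no_reflected_pole:
  assumes h: "h nicely_meromorphic_on ball 0 1" and a: "a \<in> ball 0 1"
  shows "\<forall>\<^sub>F z in at a. z \<in> ball 0 1 \<and> \<not> is_pole h z \<and> \<not> is_pole h (- cnj z)"
proof -
  have np: "\<forall>\<^sub>F z in at b. \<not> is_pole h z" if "b \<in> ball 0 1" for b
    using h that eventually_cosparse_imp_eventually_at[OF meromorphic_on_imp_not_pole_cosparse, of h "ball 0 1" b UNIV]
    by (simp add: nicely_meromorphic_on_def)
  have "- cnj a \<in> ball 0 1" using a by simp
  then have "\<forall>\<^sub>F z in at a. \<not> is_pole h (- cnj z)"
    using eventually_compose_filterlim[OF np tendsto_reflection] by blast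
  moreover have "\<forall>\<^sub>F z in at a. z \<in> ball 0 1"
    using a by (intro eventually_at_in_open') auto
  ultimately show ?thesis
    using np[OF a] by eventually_elim blast
qed

text \<open>
  A reflection relation with factor \<open>exp (2 i l - 2 K z)\<close> is turned into an exact symmetry by
  splitting off the square root \<open>exp (i l - K z)\<close> of this factor. At poles the relation carries no direct
  information, but it forces the set of poles to be symmetric: a pole of \<open>h\<close> at \<open>z\<close> without
  a pole at \<open>- cnj z\<close> would contradict the boundedness of the right side near \<open>z\<close>.
\<close>

lemma symmetrised_function:
  fixes K l :: real
  assumes h: "h nicely_meromorphic_on ball 0 1"
    and rel: "\<And>z. z \<in> ball 0 1 \<Longrightarrow> \<not> is_pole h z \<Longrightarrow> \<not> is_pole h (- cnj z) \<Longrightarrow>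
      h z = exp (\<i> * of_real (2 * l)) * exp (- of_real (2 * K) * z) * cnj (h (- cnj z))"
  defines "f \<equiv> \<lambda>z. h z * exp (of_real K * z - \<i> * of_real l)"
  shows "f nicely_meromorphic_on ball 0 1" and "\<And>z. z \<in> ball 0 1 \<Longrightarrow> f z = cnj (f (- cnj z))"
    and "\<And>z. h z = f z * exp (- of_real K * z + \<i> * of_real l)"
proof -
  have an: "(\<lambda>z. exp (of_real K * z - \<i> * of_real l)) analytic_on A" for A
    by (intro analytic_intros)
  have pole_0: "h z = 0" if "z \<in> ball 0 1" "is_pole h z" for z
    using h that not_tendsto_and_filterlim_at_infinity[OF trivial_limit_at, of h "h z" z]
    unfolding nicely_meromorphic_on_def is_pole_def by blast
  show "f nicely_meromorphic_on ball 0 1"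
    unfolding nicely_meromorphic_on_def
  proof (intro conjI ballI)
    show "f meromorphic_on ball 0 1"
      unfolding f_def using h
      by (intro meromorphic_on_mult analytic_on_imp_meromorphic_on[OF an]) (simp add: nicely_meromorphic_on_def)
    fix z :: complex assume z: "z \<in> ball 0 1"
    show "is_pole f z \<and> f z = 0 \<or> f \<midarrow>z\<rightarrow> f z"
    proof (cases "is_pole h z")
      case True
      then have "is_pole f z"
        unfolding f_def by (rule is_pole_mult_analytic_nonzero2[OF _ an]) simp
      then show ?thesis using pole_0[OF z True] by (simp add: f_def)
    next
      case False
      then have "h analytic_on {z}"
        using nicely_meromorphic_on_imp_analytic_at[OF h z] by blast
      then have "f analytic_on {z}"
        unfolding f_def by (rule analytic_on_mult[OF _ an])
      then show ?thesis using analytic_at_imp_isCont isCont_def by blast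
    qed
  qed
  have sym: "is_pole h (- cnj z)" if z: "z \<in> ball 0 1" and pole: "is_pole h z" for z
  proof (rule ccontr)
    assume np: "\<not> is_pole h (- cnj z)"
    have "- cnj z \<in> ball 0 1" using z by simp
    then have "isCont h (- cnj z)"
      using nicely_meromorphic_on_imp_analytic_at[OF h _ np] analytic_at_imp_isCont by blast
    then have "isCont (\<lambda>w. h (- cnj w)) z"
      by (rule isCont_o2[rotated]) simp
    then have "isCont (\<lambda>w. cnj (h (- cnj w))) z"
      by (rule continuous_cnj)
    then have "isCont (\<lambda>w. exp (\<i> * of_real (2 * l)) * exp (- of_real (2 * K) * w) * cnj (h (- cnj w))) z"
      by (intro isCont_mult) simp_all
    then obtain c where "((\<lambda>w. exp (\<i> * of_real (2 * l)) * exp (- of_real (2 * K) * w) * cnj (h (- cnj w))) \<longlongrightarrow> c) (at z)"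
      unfolding isCont_def by blast
    moreover have "\<forall>\<^sub>F w in at z. exp (\<i> * of_real (2 * l)) * exp (- of_real (2 * K) * w) * cnj (h (- cnj w)) = h w"
      using eventually_no_pole_and_no_reflected_pole[OF h z] by eventually_elim (rule rel[symmetric]; simp)
    ultimately have "(h \<longlongrightarrow> c) (at z)"
      by (rule Lim_transform_eventually)
    then show False
      using pole not_tendsto_and_filterlim_at_infinity[OF trivial_limit_at] unfolding is_pole_def by blast
  qed
  show "f z = cnj (f (- cnj z))" if z: "z \<in> ball 0 1" for z
  proof (cases "is_pole h z")
    case True
    moreover have "- cnj z \<in> ball 0 1" using z by simp
    ultimately show ?thesis
      using sym[OF z True] pole_0 z by (simp add: f_def)
  next
    case False
    have z': "- cnj z \<in> ball 0 1" using z by simp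
    have "\<not> is_pole h (- cnj z)"
      using sym[OF z'] False by auto
    from rel[OF z False this] have "f z = cnj (h (- cnj z)) *
        exp (\<i> * of_real (2 * l) + - of_real (2 * K) * z + (of_real K * z - \<i> * of_real l))"
      unfolding f_def exp_add by (simp only: mult_ac)
    also have "\<i> * of_real (2 * l) + - of_real (2 * K) * z + (of_real K * z - \<i> * of_real l)
        = cnj (of_real K * (- cnj z) - \<i> * of_real l)"
      by (simp add: algebra_simps)
    finally show ?thesis by (simp add: f_def exp_cnj)
  qed
  show "h z = f z * exp (- of_real K * z + \<i> * of_real l)" for z
    by (simp add: f_def mult.assoc flip: exp_add)
qed

lemma limit_values:
  assumes F: "(\<lambda>k. to_sphere (F k) z) \<longlonglongrightarrow> to_sphere h z" and z: "\<not> is_pole h z"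
  shows "(\<lambda>k. F k z) \<longlonglongrightarrow> h z" and "\<forall>\<^sub>F k in sequentially. \<not> is_pole (F k) z"
proof -
  have lim: "(\<lambda>k. to_sphere (F k) z) \<longlonglongrightarrow> Fin (h z)"
    using F z by (simp add: to_sphere_def)
  show np: "\<forall>\<^sub>F k in sequentially. \<not> is_pole (F k) z"
    using tendsto_Fin_imp_tendsto_affine_value(2)[OF lim] by eventually_elim (auto simp: to_sphere_def)
  have "\<forall>\<^sub>F k in sequentially. affine_value (to_sphere (F k) z) = F k z"
    using np by eventually_elim (simp add: to_sphere_def)
  with tendsto_Fin_imp_tendsto_affine_value(1)[OF lim] show "(\<lambda>k. F k z) \<longlonglongrightarrow> h z"
    by (rule Lim_transform_eventually)
qed

text \<open>
  The passage to the limit in a functional equation with factors \<open>u\<^sub>k exp (- d m\<^sub>k z + E\<^sub>k)\<close>, where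
  \<open>\<bar>u\<^sub>k\<bar> = 1\<close>. If \<open>m\<^sub>k\<close> tends to infinity, the factors tend to \<open>0\<close> in the right half of the disc, and so
  \<open>h\<close> vanishes there wherever \<open>h(z)\<close> and \<open>h(- cnj z)\<close> are finite; by the identity theorem it vanishes
  everywhere. If \<open>m\<^sub>k\<close> tends to \<open>c\<close> and \<open>r\<^sub>k\<close> to \<open>0\<close>, then \<open>E\<^sub>k\<close> tends to \<open>0\<close>, and a subsequence
  of the factors converges to \<open>v exp (- d c z)\<close> with \<open>\<bar>v\<bar> = 1\<close>.
\<close>

lemma limit_cases_of_functional_equation:
  fixes F :: "nat \<Rightarrow> complex \<Rightarrow> complex" and u :: "nat \<Rightarrow> complex" and m r :: "nat \<Rightarrow> real"
  assumes d: "d > 0" and C: "C \<ge> 0"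
    and u: "\<forall>\<^sub>F k in sequentially. cmod (u k) = 1"
    and fe: "\<forall>\<^sub>F k in sequentially. \<forall>z\<in>ball 0 1. \<exists>E. cmod E \<le> C * r k \<and>
      (\<not> is_pole (F k) z \<longrightarrow> \<not> is_pole (F k) (- cnj z) \<longrightarrow>
       F k z = u k * exp (- of_real (d * m k) * z + E) * cnj (F k (- cnj z)))"
    and F: "\<forall>z\<in>ball 0 1. (\<lambda>k. to_sphere (F k) z) \<longlonglongrightarrow> g z"
    and h: "h nicely_meromorphic_on ball 0 1" and g: "\<forall>z\<in>ball 0 1. g z = to_sphere h z"
  shows "filterlim m at_top sequentially \<Longrightarrow> (\<And>k. r k \<le> 1) \<Longrightarrow> \<forall>z\<in>ball 0 1. g z = Fin 0"
    and "m \<longlonglongrightarrow> c \<Longrightarrow> r \<longlonglongrightarrow> 0 \<Longrightarrow> \<exists>l f. 0 \<le> l \<and> l < pi \<and> f nicely_meromorphic_on ball 0 1 \<and>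
      (\<forall>z\<in>ball 0 1. f z = cnj (f (- cnj z))) \<and>
      (\<forall>z\<in>ball 0 1. g z = to_sphere (\<lambda>w. f w * exp (- of_real (c * d / 2) * w + \<i> * of_real l)) z)"
proof -
  have lim: "(\<lambda>k. F k z) \<longlonglongrightarrow> h z" "\<forall>\<^sub>F k in sequentially. \<not> is_pole (F k) z"
    if "z \<in> ball 0 1" "\<not> is_pole h z" for z
    using limit_values[of F z h] F g that by auto
  have refl_in: "- cnj z \<in> ball 0 1" if "z \<in> ball 0 1" for z :: complex
    using that by simp
  have rel: "\<exists>E. \<forall>\<^sub>F k in sequentially. cmod (E k) \<le> C * r k \<and>
      F k z = u k * exp (- of_real (d * m k) * z + E k) * cnj (F k (- cnj z))"
    if z: "z \<in> ball 0 1" "\<not> is_pole h z" "\<not> is_pole h (- cnj z)" for z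
  proof -
    have ev: "\<forall>\<^sub>F k in sequentially. \<exists>E. cmod E \<le> C * r k \<and>
        F k z = u k * exp (- of_real (d * m k) * z + E) * cnj (F k (- cnj z))"
      using fe lim(2)[OF z(1,2)] lim(2)[OF refl_in[OF z(1)] z(3)]
    proof eventually_elim
      case (elim k)
      then show ?case using z(1) by blast
    qed
    show ?thesis
      by (rule exI[of _ "\<lambda>k. SOME E. cmod E \<le> C * r k \<and>
        F k z = u k * exp (- of_real (d * m k) * z + E) * cnj (F k (- cnj z))"])
        (use ev in eventually_elim, rule someI_ex)
  qed
  show "\<forall>z\<in>ball 0 1. g z = Fin 0" if m: "filterlim m at_top sequentially" and r: "\<And>k. r k \<le> 1"
  proof -
    have zero: "h z = 0" if z: "z \<in> ball 0 1" "\<not> is_pole h z" "\<not> is_pole h (- cnj z)" "Re z > 0" for z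
    proof -
      obtain E where E: "\<forall>\<^sub>F k in sequentially. cmod (E k) \<le> C * r k \<and>
          F k z = u k * exp (- of_real (d * m k) * z + E k) * cnj (F k (- cnj z))"
        using rel z by blast
      have "\<forall>\<^sub>F k in sequentially. cmod (F k z) \<le> exp (- (d * m k) * Re z + C) * cmod (F k (- cnj z))"
        using E u
      proof eventually_elim
        case (elim k)
        have "Re (E k) \<le> C"
          using complex_Re_le_cmod[of "E k"] elim(1) mult_left_mono[OF r[of k] C] by linarith
        then show ?case
          using elim by (simp add: norm_mult mult_right_mono)
      qed
      moreover have "(\<lambda>k. exp (- (d * m k) * Re z + C) * cmod (F k (- cnj z))) \<longlonglongrightarrow> 0 * cmod (h (- cnj z))"
      proof (intro tendsto_mult tendsto_norm lim(1)[OF refl_in[OF z(1)] z(3)])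
        have "((\<lambda>x. exp (- (d * x) * Re z + C)) \<longlongrightarrow> 0) at_top"
          using d z(4) by real_asymp
        then show "(\<lambda>k. exp (- (d * m k) * Re z + C)) \<longlonglongrightarrow> 0"
          using m by (rule filterlim_compose)
      qed
      ultimately have "(\<lambda>k. F k z) \<longlonglongrightarrow> 0"
        using Lim_null_comparison[of "\<lambda>k. F k z"] by simp
      then show ?thesis
        using lim(1)[OF z(1,2)] LIMSEQ_unique by blast
    qed
    have half: "(1/2 :: complex) \<in> ball 0 1" by (simp add: norm_divide)
    have "\<forall>\<^sub>F z in at (1/2 :: complex). z \<in> {z. Re z > 0}"
      by (intro eventually_at_in_open' open_halfspace_Re_gt) simp
    with eventually_no_pole_and_no_reflected_pole[OF h half]
    have "\<forall>\<^sub>F z in at (1/2). h z = 0"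
      by eventually_elim (simp add: zero)
    then have "\<exists>\<^sub>F z in at (1/2). h z = 0"
      by (rule eventually_frequently[rotated]) simp
    then have h0: "h z = 0" if "z \<in> ball 0 1" for z
      by (rule frequently_eq_meromorphic_imp_constant[OF _ h open_ball connected_ball half that])
    show ?thesis
    proof
      fix z :: complex assume z: "z \<in> ball 0 1"
      then have "\<forall>\<^sub>F w in at z. w \<in> ball 0 1"
        by (intro eventually_at_in_open') auto
      then have "\<forall>\<^sub>F w in at z. h w = 0"
        by eventually_elim (rule h0)
      then have "\<not> is_pole h z"
        by (intro frequently_const_imp_not_is_pole[of _ 0] eventually_frequently) simp_all
      then show "g z = Fin 0" using g z h0 by (simp add: to_sphere_def)
    qed
  qed
  show "\<exists>l f. 0 \<le> l \<and> l < pi \<and> f nicely_meromorphic_on ball 0 1 \<and>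
      (\<forall>z\<in>ball 0 1. f z = cnj (f (- cnj z))) \<and>
      (\<forall>z\<in>ball 0 1. g z = to_sphere (\<lambda>w. f w * exp (- of_real (c * d / 2) * w + \<i> * of_real l)) z)"
    if m: "m \<longlonglongrightarrow> c" and r: "r \<longlonglongrightarrow> 0"
  proof -
    obtain N where N: "\<And>k. k \<ge> N \<Longrightarrow> cmod (u k) = 1"
      using u unfolding eventually_sequentially by blast
    \<comment> \<open>The phases \<open>u\<^sub>k\<close> need not converge, but passing to a subsequence does not change the limit \<open>g\<close>.\<close>
    have "\<forall>n. u (n + N) \<in> sphere 0 1"
      using N by simp
    then obtain v \<phi> where v: "v \<in> sphere 0 1" and \<phi>: "strict_mono \<phi>" and sub: "((\<lambda>n. u (n + N)) \<circ> \<phi>) \<longlonglongrightarrow> v"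
      using compact_sphere[of "0::complex" 1] unfolding compact_def by metis
    define \<psi> where "\<psi> n = \<phi> n + N" for n
    have \<psi>: "filterlim \<psi> sequentially sequentially"
      unfolding \<psi>_def by (intro filterlim_at_top_mono[OF filterlim_subseq[OF \<phi>]]) auto
    have u_lim: "(\<lambda>n. u (\<psi> n)) \<longlonglongrightarrow> v"
      using sub by (simp add: o_def \<psi>_def)
    \<comment> \<open>Halving an argument in \<open>[0, 2 \<pi>)\<close> puts \<open>l\<close> into \<open>[0, \<pi>)\<close>.\<close>
    define l where "l = Arg2pi v / 2"
    have v_l: "v = exp (\<i> * of_real (2 * l))"
      using Arg2pi_eq[of v] v by (simp add: l_def)
    have l: "0 \<le> l" "l < pi"
      using Arg2pi_ge_0[of v] Arg2pi_lt_2pi[of v] by (auto simp: l_def)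
    have h_rel: "h z = exp (\<i> * of_real (2 * l)) * exp (- of_real (2 * (c * d / 2)) * z) * cnj (h (- cnj z))"
      if z: "z \<in> ball 0 1" "\<not> is_pole h z" "\<not> is_pole h (- cnj z)" for z
    proof -
      obtain E where E: "\<forall>\<^sub>F k in sequentially. cmod (E k) \<le> C * r k \<and>
          F k z = u k * exp (- of_real (d * m k) * z + E k) * cnj (F k (- cnj z))"
        using rel z by blast
      have "(\<lambda>k. C * r k) \<longlonglongrightarrow> C * 0"
        by (intro tendsto_mult tendsto_const r)
      then have "E \<longlonglongrightarrow> 0"
        using Lim_null_comparison[of E "\<lambda>k. C * r k"] E by (simp add: eventually_conj_iff)
      then have "(\<lambda>k. exp (- of_real (d * m k) * z + E k)) \<longlonglongrightarrow> exp (- of_real (d * c) * z + 0)"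
        by (intro tendsto_exp tendsto_add tendsto_mult tendsto_minus tendsto_of_real tendsto_const m)
      then have "(\<lambda>n. u (\<psi> n) * exp (- of_real (d * m (\<psi> n)) * z + E (\<psi> n)) * cnj (F (\<psi> n) (- cnj z)))
          \<longlonglongrightarrow> v * exp (- of_real (d * c) * z + 0) * cnj (h (- cnj z))"
        using lim(1)[OF refl_in[OF z(1)] z(3)]
        by (intro tendsto_mult tendsto_cnj u_lim) (erule filterlim_compose[OF _ \<psi>])+
      moreover have "\<forall>\<^sub>F n in sequentially.
          u (\<psi> n) * exp (- of_real (d * m (\<psi> n)) * z + E (\<psi> n)) * cnj (F (\<psi> n) (- cnj z)) = F (\<psi> n) z"
        using eventually_compose_filterlim[OF E \<psi>] by eventually_elim simp
      ultimately have "(\<lambda>n. F (\<psi> n) z) \<longlonglongrightarrow> v * exp (- of_real (d * c) * z + 0) * cnj (h (- cnj z))"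
        by (rule Lim_transform_eventually)
      moreover have "(\<lambda>n. F (\<psi> n) z) \<longlonglongrightarrow> h z"
        using filterlim_compose[OF lim(1)[OF z(1,2)] \<psi>] .
      ultimately have "h z = v * exp (- of_real (d * c) * z + 0) * cnj (h (- cnj z))"
        by (rule LIMSEQ_unique[rotated])
      then show ?thesis
        unfolding v_l by (simp add: mult_ac)
    qed
    define f where "f = (\<lambda>z. h z * exp (of_real (c * d / 2) * z - \<i> * of_real l))"
    note sym = symmetrised_function[where h = h and l = l and K = "c * d / 2", OF h]
    have "f nicely_meromorphic_on ball 0 1"
      unfolding f_def by (rule sym(1)) (rule h_rel)
    moreover have "f z = cnj (f (- cnj z))" if "z \<in> ball 0 1" for z
      unfolding f_def by (rule sym(2)[OF _ that]) (rule h_rel)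
    moreover have "h = (\<lambda>w. f w * exp (- of_real (c * d / 2) * w + \<i> * of_real l))"
      unfolding f_def by (intro ext sym(3)) (rule h_rel)
    then have "\<forall>z\<in>ball 0 1. g z = to_sphere (\<lambda>w. f w * exp (- of_real (c * d / 2) * w + \<i> * of_real l)) z"
      using g by simp
    ultimately show ?thesis
      using l by blast
  qed
qed

theorem proposition2p1:
  fixes G :: "complex \<Rightarrow> complex" and \<mu> :: "real \<Rightarrow> real"
    and \<tau> :: "nat \<Rightarrow> real" and g :: "complex \<Rightarrow> riemann_sphere"
  assumes "G \<in> class_G" and "degree_G G > 0"
    and "\<And>t. t \<ge> 2 \<Longrightarrow> 0 < \<mu> t \<and> \<mu> t \<le> ln t / 2"
    and "\<And>k. \<tau> k \<ge> 2" and "filterlim \<tau> at_top sequentially"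
    and "locally_uniform_limit (ball 0 1) (\<lambda>k. to_sphere (rescaled G \<mu> (\<tau> k))) g"
  shows "(filterlim (\<lambda>k. \<mu> (\<tau> k)) at_top sequentially \<longrightarrow>
            (\<forall>z\<in>ball 0 1. g z = Fin 0) \<or> (\<forall>z\<in>ball 0 1. g z = Infty)) \<and>
         (\<forall>c>0. (\<lambda>k. \<mu> (\<tau> k)) \<longlonglongrightarrow> c \<longrightarrow>
            (\<forall>z\<in>ball 0 1. g z = Infty) \<or>
            (\<exists>l f. 0 \<le> l \<and> l < pi \<and> f nicely_meromorphic_on ball 0 1 \<and>
               (\<forall>z\<in>ball 0 1. f z = cnj (f (- cnj z))) \<and>
               (\<forall>z\<in>ball 0 1. g z =
                  to_sphere (\<lambda>w. f w * exp (- of_real (c * degree_G G / 2) * w + \<i> * of_real l)) z))) \<and>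
         ((\<lambda>k. \<mu> (\<tau> k)) \<longlonglongrightarrow> 0 \<longrightarrow>
            (\<forall>z\<in>ball 0 1. g z = Infty) \<or>
            (\<exists>l f. 0 \<le> l \<and> l < pi \<and> f nicely_meromorphic_on ball 0 1 \<and>
               (\<forall>z\<in>ball 0 1. f z = cnj (f (- cnj z))) \<and>
               (\<forall>z\<in>ball 0 1. g z = to_sphere (\<lambda>w. f w * exp (\<i> * of_real l)) z)))"
proof -
  let ?F = "\<lambda>k. rescaled G \<mu> (\<tau> k)"
  \<comment> \<open>The degree of \<open>G\<close> is read off from this particular tuple, so its functional equation is the one to
    use.\<close>
  define p where "p = (SOME p. admissible p \<and> satisfies_fe G p)"
  have G: "G nicely_meromorphic_on half_strip"
    using assms(1) by (simp add: class_G_def)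
  have p: "admissible p" "satisfies_fe G p"
    using assms(1) someI_ex[of "\<lambda>p. admissible p \<and> satisfies_fe G p"] by (auto simp: class_G_def p_def)
  have deg: "degree_G G = param_degree p"
    by (simp add: degree_G_def p_def)
  have F_mero: "?F k nicely_meromorphic_on ball 0 1" for k
    using assms(3)[OF assms(4)[of k]] assms(4)[of k] by (intro rescaled_nicely_meromorphic(1)[OF G]) auto
  have F_lim: "\<forall>z\<in>ball 0 1. (\<lambda>k. to_sphere (?F k) z) \<longlonglongrightarrow> g z"
  proof
    fix z :: complex assume "z \<in> ball 0 1"
    then have "compact {z} \<and> {z} \<subseteq> ball 0 1" by simp
    then have "uniform_limit {z} (\<lambda>k. to_sphere (?F k)) g sequentially"
      using assms(6) unfolding locally_uniform_limit_def by blast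
    then show "(\<lambda>k. to_sphere (?F k) z) \<longlonglongrightarrow> g z"
      by (rule tendsto_uniform_limitI) simp
  qed
  have infty_or: "(\<forall>z\<in>ball 0 1. g z = Infty) \<or>
      (\<exists>h. h nicely_meromorphic_on ball 0 1 \<and> (\<forall>z\<in>ball 0 1. g z = to_sphere h z))"
    using meromorphic_limit_cases[OF open_ball connected_ball F_mero assms(6)] by metis
  then show ?thesis
  proof (elim disjE exE conjE)
    fix h assume h: "h nicely_meromorphic_on ball 0 1" and gh: "\<forall>z\<in>ball 0 1. g z = to_sphere h z"
    obtain C where C: "C \<ge> 0" and fe: "\<forall>\<^sub>F t in at_top. \<forall>z\<in>ball 0 1. \<exists>E. cmod E \<le> C * (\<mu> t / ln t) \<and>
      (\<not> is_pole (rescaled G \<mu> t) z \<longrightarrow> \<not> is_pole (rescaled G \<mu> t) (- cnj z) \<longrightarrow>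
       rescaled G \<mu> t z = Delta p (1/2 + \<i> * of_real t) *
         exp (- of_real (param_degree p * \<mu> t) * z + E) * cnj (rescaled G \<mu> t (- cnj z)))"
      by (rule rescaled_functional_equation[OF p G assms(3)])
    have d: "param_degree p > 0" using assms(2) deg by simp
    note cases = limit_cases_of_functional_equation[OF d C
        eventually_compose_filterlim[OF norm_Delta_critical_line[OF p(1)] assms(5)]
        eventually_compose_filterlim[OF fe assms(5)] F_lim h gh, folded deg]
    have ln_lim: "filterlim (\<lambda>k. ln (\<tau> k)) at_top sequentially"
      by (rule filterlim_compose[OF ln_at_top assms(5)])
    have r_lim: "(\<lambda>k. \<mu> (\<tau> k) / ln (\<tau> k)) \<longlonglongrightarrow> 0" if "(\<lambda>k. \<mu> (\<tau> k)) \<longlonglongrightarrow> c" for c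
      using that filterlim_at_top_imp_at_infinity[OF ln_lim] by (rule tendsto_divide_0)
    have r_le: "\<mu> (\<tau> k) / ln (\<tau> k) \<le> 1" for k
      using assms(3)[OF assms(4)[of k]] assms(4)[of k] by (simp add: field_simps)
    show ?thesis
    proof (intro conjI impI allI)
      assume "filterlim (\<lambda>k. \<mu> (\<tau> k)) at_top sequentially"
      then show "(\<forall>z\<in>ball 0 1. g z = Fin 0) \<or> (\<forall>z\<in>ball 0 1. g z = Infty)"
        using cases(1)[OF _ r_le] by blast
    next
      fix c :: real assume "(\<lambda>k. \<mu> (\<tau> k)) \<longlonglongrightarrow> c"
      then show "(\<forall>z\<in>ball 0 1. g z = Infty) \<or>
            (\<exists>l f. 0 \<le> l \<and> l < pi \<and> f nicely_meromorphic_on ball 0 1 \<and>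
               (\<forall>z\<in>ball 0 1. f z = cnj (f (- cnj z))) \<and>
               (\<forall>z\<in>ball 0 1. g z =
                  to_sphere (\<lambda>w. f w * exp (- of_real (c * degree_G G / 2) * w + \<i> * of_real l)) z))"
        using cases(2) r_lim by blast
    next
      assume m0: "(\<lambda>k. \<mu> (\<tau> k)) \<longlonglongrightarrow> 0"
      show "(\<forall>z\<in>ball 0 1. g z = Infty) \<or>
            (\<exists>l f. 0 \<le> l \<and> l < pi \<and> f nicely_meromorphic_on ball 0 1 \<and>
               (\<forall>z\<in>ball 0 1. f z = cnj (f (- cnj z))) \<and>
               (\<forall>z\<in>ball 0 1. g z = to_sphere (\<lambda>w. f w * exp (\<i> * of_real l)) z))"
        using cases(2)[OF m0 r_lim[OF m0]] by simp
    qed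
  qed simp
qed

end
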